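(* Let $n\ge 4$ and $d\ge 3$ be integers, and let $Y$ be the single voltage cover of the complete graph $K_n$ by the cyclic group of order $d$. Then $$\mathcal J(Y)\cong (\mathbb Z/n\mathbb Z)^{(n-4)d+2}\oplus(\mathbb Z/n(n-2)\mathbb Z)^{d-2}\oplus \mathbb Z/dn(n-2)\mathbb Z .$$ In particular, $|\mathcal J(Y)|=n^{(n-3)d+1}\,(n-2)^{d-1}\,d$, and the rank of $\mathcal J(Y)$ (its number of invariant factors, i.e. its minimal number of generators) is $(n-3)d+1$.
   Context: Graphs are simple (no loops or multiple edges). For a finite connected graph $Y$ with Laplacian $L=D-A$ (degree matrix minus adjacency matrix), a reduced Laplacian $\widetilde L$ is obtained by deleting the row and column of one vertex, and the Jacobian of $Y$ is the finite abelian group $\mathcal J(Y)=\mathrm{coker}(\widetilde L)$ (up to isomorphism independent of the vertex chosen). Single voltage cover of $K_n$ by the cyclic group $G=\langle\tau\rangle$ of order $d$: label the vertices of $K_n$ as $v_1,\dots,v_n$. Assign to the directed edge $v_1\to v_2$ the voltage $\alpha_{1,2}=\tau$, to $v_2\to v_1$ the voltage $\alpha_{2,1}=\tau^{-1}$, and to every other directed edge $v_i\to v_j$ the voltage $\alpha_{i,j}=1$ (the identity). The cover (derived graph) $Y$ has vertex set $\{v_{i,g}: 1\le i\le n,\ g\in G\}$, and $v_{i,g}$ is adjacent to $v_{j,h}$ if and only if $i\ne j$ and $h=g\alpha_{i,j}$. *)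

theory Defs
  imports "HOL-Algebra.Product_Groups" "HOL-Algebra.Generated_Groups" "Graph_Theory.Graph_Theory"
begin

text \<open>
  A finite simple graph is a \<^locale>\<open>pair_graph\<close>: each undirected edge appears as two
  opposite arcs, so the out-degree of a vertex is its degree.
\<close>

definition complete_pair_graph :: "nat \<Rightarrow> nat pair_pre_digraph" where
  "complete_pair_graph n =
     \<lparr>pverts = {1..n}, parcs = {(i, j). i \<in> {1..n} \<and> j \<in> {1..n} \<and> i \<noteq> j}\<rparr>"

lemma complete_digraph_complete_pair_graph:
  "complete_digraph n (with_proj (complete_pair_graph n))"
  unfolding complete_digraph_pair_def by (auto simp: complete_pair_graph_def)

definition derived_graph ::
  "'a pair_pre_digraph \<Rightarrow> ('g, 'b) monoid_scheme \<Rightarrow> ('a \<Rightarrow> 'a \<Rightarrow> 'g) \<Rightarrow> ('a \<times> 'g) pair_pre_digraph"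
where
  "derived_graph B G \<alpha> =
     \<lparr>pverts = pverts B \<times> carrier G,
      parcs = {((i, g), (j, h)). (i, j) \<in> parcs B \<and> g \<in> carrier G \<and> h \<in> carrier G
                 \<and> h = g \<otimes>\<^bsub>G\<^esub> \<alpha> i j}\<rparr>"

definition single_voltage :: "('g, 'b) monoid_scheme \<Rightarrow> 'g \<Rightarrow> nat \<Rightarrow> nat \<Rightarrow> 'g" where
  "single_voltage G \<tau> i j =
     (if (i, j) = (1, 2) then \<tau> else if (i, j) = (2, 1) then inv\<^bsub>G\<^esub> \<tau> else \<one>\<^bsub>G\<^esub>)"

definition single_voltage_cover ::
  "nat \<Rightarrow> ('g, 'b) monoid_scheme \<Rightarrow> 'g \<Rightarrow> (nat \<times> 'g) pair_pre_digraph" where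
  "single_voltage_cover n G \<tau> = derived_graph (complete_pair_graph n) G (single_voltage G \<tau>)"

lemma pair_graph_single_voltage_cover:
  assumes "group G" and "finite (carrier G)" and "\<tau> \<in> carrier G"
  shows "pair_graph (single_voltage_cover n G \<tau>)"
proof -
  interpret group G by fact
  let ?Y = "single_voltage_cover n G \<tau>"
  have fin: "finite (pverts ?Y)"
    using assms by (simp add: single_voltage_cover_def derived_graph_def complete_pair_graph_def)
  have sub: "parcs ?Y \<subseteq> pverts ?Y \<times> pverts ?Y"
    by (auto simp: single_voltage_cover_def derived_graph_def complete_pair_graph_def)
  have sym: "sym (parcs ?Y)"
    using \<open>\<tau> \<in> carrier G\<close>
    by (auto intro!: symI simp: single_voltage_cover_def derived_graph_def complete_pair_graph_def
          single_voltage_def m_assoc)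
  show ?thesis
  proof
    show "finite (parcs ?Y)"
      using fin sub by (meson finite_SigmaI finite_subset)
    show "symmetric (with_proj ?Y)"
      using sym by (simp add: symmetric_def)
    show "fst e \<noteq> snd e" if "e \<in> parcs ?Y" for e
      using that by (auto simp: single_voltage_cover_def derived_graph_def complete_pair_graph_def)
  qed (use fin sub in auto)
qed

lemma strongly_connected_single_voltage_cover:
  assumes "group G" and "\<tau> \<in> carrier G" and gen: "generate G {\<tau>} = carrier G" and "n \<ge> 3"
  shows "strongly_connected (with_proj (single_voltage_cover n G \<tau>))"
proof -
  interpret group G by fact
  let ?Y = "single_voltage_cover n G \<tau>"
  define R where "R = (\<lambda>u v. u \<rightarrow>\<^sup>*\<^bsub>with_proj ?Y\<^esub> v)"
  interpret Y: pair_wf_digraph ?Y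
    by unfold_locales
      (auto simp: single_voltage_cover_def derived_graph_def complete_pair_graph_def)
  note defs = single_voltage_cover_def derived_graph_def complete_pair_graph_def single_voltage_def
  have R_trans: "R u w" if "R u v" "R v w" for u v w
    using that unfolding R_def by (rule Y.reachable_trans)
  have R_arc: "R u v" if "(u, v) \<in> parcs ?Y" for u v
    unfolding R_def using that by (intro Y.reachable_adjI) simp
  have R_refl: "R u u" if "u \<in> pverts ?Y" for u
    unfolding R_def using that by (simp add: Y.reachable_refl)
  have to3: "R (i, g) (3, g) \<and> R (3, g) (i, g)" if "i \<in> {1..n}" "g \<in> carrier G" for i g
  proof (cases "i = 3")
    case True
    then show ?thesis using that by (auto intro!: R_refl simp: defs)
  next
    case False
    then show ?thesis using that \<open>n \<ge> 3\<close> by (auto intro!: R_arc simp: defs)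
  qed
  have up: "R (3, g) (3, g \<otimes>\<^bsub>G\<^esub> \<tau>)" if "g \<in> carrier G" for g
  proof -
    have "R (1, g) (2, g \<otimes>\<^bsub>G\<^esub> \<tau>)"
      using that \<open>n \<ge> 3\<close> \<open>\<tau> \<in> carrier G\<close> by (auto intro!: R_arc simp: defs)
    then show ?thesis
      using to3[of 1 g] to3[of 2 "g \<otimes>\<^bsub>G\<^esub> \<tau>"] that \<open>n \<ge> 3\<close> \<open>\<tau> \<in> carrier G\<close>
      by (auto intro: R_trans)
  qed
  have down: "R (3, g) (3, g \<otimes>\<^bsub>G\<^esub> inv\<^bsub>G\<^esub> \<tau>)" if "g \<in> carrier G" for g
  proof -
    have "R (2, g) (1, g \<otimes>\<^bsub>G\<^esub> inv\<^bsub>G\<^esub> \<tau>)"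
      using that \<open>n \<ge> 3\<close> \<open>\<tau> \<in> carrier G\<close> by (auto intro!: R_arc simp: defs)
    then show ?thesis
      using to3[of 2 g] to3[of 1 "g \<otimes>\<^bsub>G\<^esub> inv\<^bsub>G\<^esub> \<tau>"] that \<open>n \<ge> 3\<close> \<open>\<tau> \<in> carrier G\<close>
      by (auto intro: R_trans)
  qed
  have mult: "R (3, g) (3, g \<otimes>\<^bsub>G\<^esub> h)" if "h \<in> generate G {\<tau>}" "g \<in> carrier G" for g h
    using that
  proof (induction h arbitrary: g rule: generate.induct)
    case one
    then show ?case using \<open>n \<ge> 3\<close> by (auto intro!: R_refl simp: defs)
  next
    case (eng h1 h2)
    have "h1 \<in> carrier G" "h2 \<in> carrier G"
      using eng.hyps gen by auto
    then show ?case
      using eng.IH(1)[OF eng.prems] eng.IH(2)[of "g \<otimes>\<^bsub>G\<^esub> h1"] eng.prems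
      by (auto simp: m_assoc intro: R_trans)
  qed (use up down in auto)
  have "R (i, g) (j, h)" if "i \<in> {1..n}" "j \<in> {1..n}" "g \<in> carrier G" "h \<in> carrier G" for i j g h
  proof -
    have "R (3, g) (3, g \<otimes>\<^bsub>G\<^esub> (inv\<^bsub>G\<^esub> g \<otimes>\<^bsub>G\<^esub> h))"
      using that gen by (intro mult) auto
    also have "g \<otimes>\<^bsub>G\<^esub> (inv\<^bsub>G\<^esub> g \<otimes>\<^bsub>G\<^esub> h) = h"
      using that by (simp add: m_assoc[symmetric])
    finally show ?thesis
      using to3[of i g] to3[of j h] that by (blast intro: R_trans)
  qed
  moreover have "pverts ?Y = {1..n} \<times> carrier G"
    by (simp add: defs)
  moreover have "pverts ?Y \<noteq> {}"
    using \<open>n \<ge> 3\<close> by (auto simp: defs)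
  ultimately show ?thesis
    by (auto simp: strongly_connected_def R_def)
qed

definition adjacency :: "'a pair_pre_digraph \<Rightarrow> 'a \<Rightarrow> 'a \<Rightarrow> int" where
  "adjacency Y u v = (if (u, v) \<in> parcs Y then 1 else 0)"

definition degree_matrix :: "'a pair_pre_digraph \<Rightarrow> 'a \<Rightarrow> 'a \<Rightarrow> int" where
  "degree_matrix Y u v = (if u = v then int (out_degree (with_proj Y) v) else 0)"

definition laplacian :: "'a pair_pre_digraph \<Rightarrow> 'a \<Rightarrow> 'a \<Rightarrow> int" where
  "laplacian Y u v = degree_matrix Y u v - adjacency Y u v"

abbreviation free_int_module :: "'a set \<Rightarrow> ('a \<Rightarrow> int) monoid" where
  "free_int_module I \<equiv> product_group I (\<lambda>_. integer_group)"

text \<open>The subgroup spanned by the columns of an \<open>I \<times> J\<close> integer matrix, for finite \<open>I\<close>, \<open>J\<close>.\<close>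

definition int_matrix_image :: "'a set \<Rightarrow> 'b set \<Rightarrow> ('a \<Rightarrow> 'b \<Rightarrow> int) \<Rightarrow> ('a \<Rightarrow> int) set" where
  "int_matrix_image I J M =
     (\<lambda>x. \<lambda>i\<in>I. \<Sum>j\<in>J. M i j * x j) ` carrier (free_int_module J)"

lemma subgroup_int_matrix_image:
  "subgroup (int_matrix_image I J M) (free_int_module I)"
proof -
  interpret A: group "free_int_module I" by simp
  interpret B: group "free_int_module J" by simp
  have "(\<lambda>x. \<lambda>i\<in>I. \<Sum>j\<in>J. M i j * x j) \<in> hom (free_int_module J) (free_int_module I)"
    by (rule homI)
      (auto simp: product_group_def integer_group_def sum.distrib distrib_left fun_eq_iff)
  then interpret group_hom "free_int_module J" "free_int_module I"
    "\<lambda>x. \<lambda>i\<in>I. \<Sum>j\<in>J. M i j * x j"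
    by unfold_locales
  show ?thesis
    unfolding int_matrix_image_def by (rule img_is_subgroup)
qed

definition int_matrix_coker ::
  "'a set \<Rightarrow> 'b set \<Rightarrow> ('a \<Rightarrow> 'b \<Rightarrow> int) \<Rightarrow> ('a \<Rightarrow> int) set monoid" where
  "int_matrix_coker I J M = free_int_module I Mod int_matrix_image I J M"

text \<open>
  Matrices are functions read on explicit finite index sets, so the Laplacian with the row and
  column of \<open>w\<close> deleted is \<^const>\<open>laplacian\<close> read on the vertices other than \<open>w\<close>.
\<close>

definition jacobian :: "'a pair_pre_digraph \<Rightarrow> 'a \<Rightarrow> ('a \<Rightarrow> int) set monoid" where
  "jacobian Y w = int_matrix_coker (pverts Y - {w}) (pverts Y - {w}) (laplacian Y)"

definition cyclic_power :: "nat \<Rightarrow> nat \<Rightarrow> (nat \<Rightarrow> int) monoid" where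
  "cyclic_power m k = product_group {..<k} (\<lambda>_. integer_mod_group m)"

definition min_generators :: "('g, 'b) monoid_scheme \<Rightarrow> nat" where
  "min_generators A =
     (LEAST k. \<exists>S \<subseteq> carrier A. finite S \<and> card S = k \<and> generate A S = carrier A)"

definition invariant_factors :: "('g, 'b) monoid_scheme \<Rightarrow> nat list \<Rightarrow> bool" where
  "invariant_factors A ms \<longleftrightarrow>
     (\<forall>m \<in> set ms. m > 1) \<and> successively (dvd) ms \<and>
     A \<cong> product_group {..<length ms} (\<lambda>i. integer_mod_group (ms ! i))"

definition num_invariant_factors :: "('g, 'b) monoid_scheme \<Rightarrow> nat" where
  "num_invariant_factors A = (THE k. \<exists>ms. invariant_factors A ms \<and> length ms = k)"

end

theory Submission
  imports Defs "HOL-Algebra.Multiplicative_Group" "HOL-Computational_Algebra.Primes"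
begin

text \<open>
  Write \<open>X i k\<close> for the value of a function at the vertex \<open>(i, \<tau>\<^sup>k)\<close>, periodic in the integer \<open>k\<close>, and
  solve \<open>L X = F\<close> for a given \<open>F\<close> of total sum zero. The rows \<open>i \<ge> 3\<close> make all \<open>X i - X 3\<close> with
  \<open>i \<ge> 4\<close> explicit, which costs divisibility by \<open>n\<close>. Summing the rows over \<open>i\<close> yields the increments of
  \<open>X 2 (k + 1) - X 1 k\<close>; with these, \<open>n - 2\<close> times \<open>\<alpha> = X 1 - X 3\<close> is explicit up to one constant, and
  the increments of \<open>X 1\<close> are explicit in \<open>\<alpha>\<close>. Periodicity of \<open>X 1\<close> fixes the constant, which costs
  divisibility by \<open>d n (n - 2)\<close>. Some conditions obtained in this way imply others, and
  \<open>(n - 3) d + 1\<close> of them remain: integral linear forms in \<open>F\<close> which take arbitrary values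
  independently and must be divisible by \<open>n\<close>, \<open>n (n - 2)\<close> or \<open>d n (n - 2)\<close>. The forms therefore
  identify the Jacobian with a product of cyclic groups. A prime dividing \<open>n\<close> divides all the moduli,
  so counting characters of that prime order gives the rank.
\<close>

section \<open>Periodic functions on the integers\<close>

definition periodic :: "nat \<Rightarrow> (int \<Rightarrow> 'a) \<Rightarrow> bool" where
  "periodic d g \<longleftrightarrow> (\<forall>k. g (k + int d) = g k)"

lemma periodic_shift: "periodic d g \<Longrightarrow> periodic d (\<lambda>k. g (k + c))"
  by (simp add: periodic_def algebra_simps) (metis add.commute add.left_commute)

lemma periodic_comp2:
  "periodic d g \<Longrightarrow> periodic d h \<Longrightarrow> periodic d (\<lambda>k. f (g k) (h k))"
  by (simp add: periodic_def)

lemma periodic_mod: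
  assumes "periodic d g"
  shows "g (k mod int d) = g k"
proof -
  have *: "g (j + int m * int d) = g j" for j m
  proof (induction m)
    case (Suc m)
    have "g (j + int (Suc m) * int d) = g ((j + int m * int d) + int d)"
      by (simp add: algebra_simps)
    then show ?case using assms Suc by (simp add: periodic_def)
  qed simp
  show ?thesis
  proof (cases "k div int d \<ge> 0")
    case True
    then show ?thesis
      using *[of "k mod int d" "nat (k div int d)"] by simp
  next
    case False
    then show ?thesis
      using *[of k "nat (- (k div int d))"] by (simp add: minus_div_mult_eq_mod)
  qed
qed

lemma sum_diff_periodic:
  fixes g :: "int \<Rightarrow> int"
  assumes "periodic d g"
  shows "(\<Sum>k<d. g (int k + 1) - g (int k)) = 0" and "(\<Sum>k<d. g (int k) - g (int k - 1)) = 0"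
proof -
  have *: "(\<Sum>k<d. h (int k + 1) - h (int k)) = 0" if "periodic d h" for h :: "int \<Rightarrow> int"
  proof -
    have "(\<Sum>k<d. h (int k + 1) - h (int k)) = (\<Sum>k<d. h (int (Suc k)) - h (int k))"
      by (simp add: add.commute)
    also have "\<dots> = h (int d) - h 0"
      by (subst sum_lessThan_telescope) simp
    also have "\<dots> = 0"
      using that by (simp add: periodic_def) (metis add_0)
    finally show ?thesis .
  qed
  show "(\<Sum>k<d. g (int k + 1) - g (int k)) = 0"
    by (rule *[OF assms])
  show "(\<Sum>k<d. g (int k) - g (int k - 1)) = 0"
    using *[OF periodic_shift[OF assms, of "-1"]] by simp
qed

text \<open>The periodic antiderivative vanishing at 0 of a periodic function whose sum over a period is 0.\<close>

definition cyclic_sum :: "nat \<Rightarrow> (int \<Rightarrow> int) \<Rightarrow> int \<Rightarrow> int" where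
  "cyclic_sum d g k = (\<Sum>j=1..k mod int d. g j)"

lemma cyclic_sum_0 [simp]: "cyclic_sum d g 0 = 0"
  by (simp add: cyclic_sum_def)

lemma periodic_cyclic_sum: "periodic d (cyclic_sum d g)"
  by (simp add: periodic_def cyclic_sum_def)

text \<open>Away from multiples of \<open>d\<close> the two partial sums differ by one term. At a
  multiple of \<open>d\<close> the partial sum drops from the sum over \<open>1..d - 1\<close> to
  zero, and the vanishing total makes the former equal to \<open>- g 0\<close>.\<close>

lemma cyclic_sum_diff:
  assumes "d > 0" and "periodic d g" and "(\<Sum>k<d. g (int k)) = 0"
  shows "cyclic_sum d g k - cyclic_sum d g (k - 1) = g k"
proof -
  have bound: "0 \<le> k mod int d" "k mod int d < int d"
    using \<open>d > 0\<close> by auto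
  show ?thesis
  proof (cases "k mod int d = 0")
    case True
    have "(k - 1) mod int d = (k mod int d - 1) mod int d"
      by (simp add: mod_simps)
    also have "\<dots> = int d - 1"
      using True \<open>d > 0\<close> by (simp add: zmod_minus1)
    finally have pred: "(k - 1) mod int d = int d - 1" .
    have "(\<Sum>k<d. g (int k)) = (\<Sum>j\<in>{0..<int d}. g j)"
      by (rule sum.reindex_bij_witness[of _ nat int]) auto
    also have "{0..<int d} = insert 0 {1..int d - 1}"
      using \<open>d > 0\<close> by auto
    finally have "(\<Sum>j=1..int d - 1. g j) = - g 0"
      using assms(3) by simp
    then show ?thesis
      using True pred periodic_mod[OF assms(2), of k] by (simp add: cyclic_sum_def)
  next
    case False
    have "(k - 1) mod int d = (k mod int d - 1) mod int d"
      by (simp add: mod_simps)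
    also have "\<dots> = k mod int d - 1"
      using False bound by (intro mod_pos_pos_trivial) auto
    finally have pred: "(k - 1) mod int d = k mod int d - 1" .
    have "{1..k mod int d} = insert (k mod int d) {1..k mod int d - 1}"
      using False bound by auto
    then show ?thesis
      using pred periodic_mod[OF assms(2), of k] by (simp add: cyclic_sum_def)
  qed
qed

lemma cyclic_sum_of_diff:
  assumes "d > 0" and "periodic d r"
  shows "cyclic_sum d (\<lambda>j. r j - r (j - 1)) k = r k - r 0"
proof -
  have "(\<Sum>j=1..int m. r j - r (j - 1)) = r (int m) - r 0" for m
  proof (induction m)
    case (Suc m)
    have "{1..int (Suc m)} = insert (int m + 1) {1..int m}" by auto
    then show ?case using Suc by (simp add: add.commute)
  qed simp
  from this[of "nat (k mod int d)"] show ?thesis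
    using \<open>d > 0\<close> periodic_mod[OF assms(2), of k] by (simp add: cyclic_sum_def)
qed

lemma cyclic_sum_add: "cyclic_sum d (\<lambda>k. g k + h k) k = cyclic_sum d g k + cyclic_sum d h k"
  by (simp add: cyclic_sum_def sum.distrib)

section \<open>The Laplacian of the cover in coordinates\<close>

text \<open>This is the row of the Laplacian at the vertex with exponent \<open>k\<close> over
  \<open>i\<close>: the Laplacian of the complete graph within layer \<open>k\<close>, corrected
  because the neighbour of \<open>(1, k)\<close> over 2 is \<open>(2, k + 1)\<close> and that of
  \<open>(2, k)\<close> over 1 is \<open>(1, k - 1)\<close>.\<close>

definition cover_laplacian :: "nat \<Rightarrow> (nat \<Rightarrow> int \<Rightarrow> int) \<Rightarrow> nat \<Rightarrow> int \<Rightarrow> int" where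
  "cover_laplacian n X i k =
     int n * X i k - (\<Sum>j=1..n. X j k)
     - (if i = 1 then X 2 (k + 1) - X 2 k else if i = 2 then X 1 (k - 1) - X 1 k else 0)"

text \<open>
  The forms below are obtained by eliminating \<open>X\<close> from \<open>F = cover_laplacian n X\<close>. For \<open>\<alpha> = X 1 - X 3\<close>
  they evaluate to \<open>n (n - 2) (\<alpha> k - \<alpha> 0)\<close>, to \<open>n\<close> times the sum of \<open>\<alpha>\<close> over a period, and to
  \<open>d n (n - 2) \<alpha> 0\<close>.
\<close>

definition C_form :: "nat \<Rightarrow> nat \<Rightarrow> (nat \<Rightarrow> int \<Rightarrow> int) \<Rightarrow> int \<Rightarrow> int" where
  "C_form n d F k =
     ((\<Sum>i=4..n. F i k - F 3 k) + int n * F 1 k) - ((\<Sum>i=4..n. F i 0 - F 3 0) + int n * F 1 0)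
     - int n * cyclic_sum d (\<lambda>k. \<Sum>i=1..n. F i k) k"

definition E_form :: "nat \<Rightarrow> (nat \<Rightarrow> int \<Rightarrow> int) \<Rightarrow> int" where
  "E_form d F = (\<Sum>k<d. F 1 (int k) - F 3 (int k))"

definition T_form :: "nat \<Rightarrow> nat \<Rightarrow> (nat \<Rightarrow> int \<Rightarrow> int) \<Rightarrow> int" where
  "T_form n d F = (int n - 2) * E_form d F - (\<Sum>k<d. C_form n d F (int k))"

section \<open>Solving the Laplace equation by elimination\<close>

lemma sum_1_n:
  fixes f :: "nat \<Rightarrow> int"
  assumes "n \<ge> 4"
  shows "(\<Sum>i=1..n. f i) = f 1 + f 2 + f 3 + (\<Sum>i=4..n. f i)"
proof -
  have "{1..n} = {1,2,3} \<union> {4..n}" using assms by auto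
  then show ?thesis by (simp add: sum.union_disjoint)
qed

text \<open>The complete-graph part has zero column sums, so only the two voltage corrections
  survive. In terms of \<open>r k = X 2 (k + 1) - X 1 k\<close> they amount to
  \<open>r (k - 1) - r k\<close>, which determines \<open>r\<close> up to a constant.\<close>

lemma sum_cover_laplacian:
  assumes "n \<ge> 4"
  shows "(\<Sum>i=1..n. cover_laplacian n X i k) = (X 1 k - X 1 (k - 1)) - (X 2 (k + 1) - X 2 k)"
proof -
  have "(\<Sum>i=1..n. cover_laplacian n X i k)
      = (\<Sum>i=1..n. int n * X i k - (\<Sum>j=1..n. X j k)) - (X 2 (k + 1) - X 2 k) - (X 1 (k - 1) - X 1 k)"
    unfolding sum_1_n[OF assms, of "\<lambda>i. cover_laplacian n X i k"]
      sum_1_n[OF assms, of "\<lambda>i. int n * X i k - (\<Sum>j=1..n. X j k)"]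
    by (simp add: cover_laplacian_def)
  also have "(\<Sum>i=1..n. int n * X i k - (\<Sum>j=1..n. X j k)) = 0"
    by (simp add: sum_subtractf sum_distrib_left[symmetric])
  finally show ?thesis by simp
qed

lemma sum_sum_cover_laplacian:
  assumes "n \<ge> 4" and "\<And>i. periodic d (X i)"
  shows "(\<Sum>k<d. \<Sum>i=1..n. cover_laplacian n X i (int k)) = 0"
  unfolding sum_cover_laplacian[OF assms(1)]
  using sum_diff_periodic[OF assms(2)] by (simp add: sum_subtractf)

lemma cover_laplacian_shift:
  "cover_laplacian n (\<lambda>i k. X i k - c) i k = cover_laplacian n X i k"
  by (simp add: cover_laplacian_def sum_subtractf algebra_simps)

text \<open>This elimination yields the necessary conditions. Subtracting row 3 removes the layer
  sum, summing over a period removes the shift correction, and \<open>C_form\<close> removes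
  \<open>X 2\<close> and all \<open>X i\<close> with \<open>i >= 4\<close>.\<close>

lemma cover_laplacian_forms:
  assumes "n \<ge> 4" and "d > 0" and per: "\<And>i. periodic d (X i)"
    and F: "\<forall>i\<in>{1..n}. \<forall>k. F i k = cover_laplacian n X i k"
  shows "\<And>i k. i \<in> {4..n} \<Longrightarrow> F i k - F 3 k = int n * (X i k - X 3 k)"
    and "E_form d F = int n * (\<Sum>k<d. X 1 (int k) - X 3 (int k))"
    and "\<And>k. C_form n d F k = int n * (int n - 2) * ((X 1 k - X 3 k) - (X 1 0 - X 3 0))"
    and "T_form n d F = int d * int n * (int n - 2) * (X 1 0 - X 3 0)"
proof -
  show D: "F i k - F 3 k = int n * (X i k - X 3 k)" if "i \<in> {4..n}" for i k
    using that \<open>n \<ge> 4\<close> by (simp add: F cover_laplacian_def algebra_simps)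
  have "F 1 k - F 3 k = int n * (X 1 k - X 3 k) - (X 2 (k + 1) - X 2 k)" for k
    using \<open>n \<ge> 4\<close> by (simp add: F cover_laplacian_def algebra_simps)
  then show E: "E_form d F = int n * (\<Sum>k<d. X 1 (int k) - X 3 (int k))"
    using sum_diff_periodic(1)[OF per[of 2]]
    by (simp add: E_form_def sum_subtractf sum_distrib_left[symmetric] right_diff_distrib[symmetric])
  define r where "r k = X 2 (k + 1) - X 1 k" for k
  have "periodic d r"
    unfolding r_def by (intro periodic_comp2[where f = minus] periodic_shift per)
  then have perr: "periodic d (\<lambda>k. - r k)"
    by (simp add: periodic_def)
  have D_sum: "(\<Sum>i=4..n. F i k - F 3 k) = int n * ((\<Sum>i=4..n. X i k) - (int n - 3) * X 3 k)" for k
  proof -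
    have "(\<Sum>i=4..n. F i k - F 3 k) = (\<Sum>i=4..n. int n * (X i k - X 3 k))"
      by (intro sum.cong refl D)
    then show ?thesis
      using \<open>n \<ge> 4\<close> by (simp add: sum_distrib_left[symmetric] sum_subtractf of_nat_diff)
  qed
  have sigma: "(\<Sum>i=1..n. F i k) = - r k - - r (k - 1)" for k
    using sum_cover_laplacian[OF \<open>n \<ge> 4\<close>, of X k] by (simp add: F r_def)
  have cs: "cyclic_sum d (\<lambda>k. \<Sum>i=1..n. F i k) k = r 0 - r k" for k
    unfolding sigma using cyclic_sum_of_diff[OF \<open>d > 0\<close> perr, of k] by simp
  \<comment> \<open>The weight \<open>n\<close> on row 1 cancels the sum of \<open>X i\<close> over
    \<open>i >= 4\<close>. The terms in \<open>X 2 k\<close> cancel as well, and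
    \<open>X 2 (k + 1)\<close> is absorbed in \<open>r k\<close>.\<close>
  have lin: "(\<Sum>i=4..n. F i k - F 3 k) + int n * F 1 k
      = int n * ((int n - 2) * (X 1 k - X 3 k) - r k)" for k
  proof -
    have F1: "F 1 k = int n * X 1 k - (X 1 k + X 2 k + X 3 k + (\<Sum>i=4..n. X i k)) - (X 2 (k + 1) - X 2 k)"
      using \<open>n \<ge> 4\<close> sum_1_n[OF \<open>n \<ge> 4\<close>, of "\<lambda>j. X j k"] by (simp add: F cover_laplacian_def)
    show ?thesis
      unfolding D_sum r_def F1 by (simp add: algebra_simps)
  qed
  show C: "C_form n d F k = int n * (int n - 2) * ((X 1 k - X 3 k) - (X 1 0 - X 3 0))" for k
    unfolding C_form_def lin cs by (simp add: algebra_simps)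
  \<comment> \<open>The sums of \<open>X 1 - X 3\<close> over a period cancel, and the constants
    subtracted in \<open>C_form\<close> leave \<open>d\<close> copies of the value at 0.\<close>
  show "T_form n d F = int d * int n * (int n - 2) * (X 1 0 - X 3 0)"
    unfolding T_form_def C E sum_distrib_left[symmetric]
    unfolding sum_subtractf by (simp add: algebra_simps)
qed

text \<open>The elimination is run backwards: \<open>a = a0 + c\<close> plays the role of
  \<open>X 1 - X 3\<close>, \<open>r k\<close> that of \<open>X 2 (k + 1) - X 1 k\<close>, and
  \<open>g\<close> that of the increments of \<open>X 1\<close>. This determines \<open>X\<close>,
  which is then checked row by row.\<close>

lemma cover_laplacian_solution:
  assumes "n \<ge> 4" and "d > 0" and per: "\<And>i. periodic d (F i)"
    and zero: "(\<Sum>k<d. \<Sum>i=1..n. F i (int k)) = 0"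
    and q: "\<And>i k. i \<in> {4..n} \<Longrightarrow> F i k - F 3 k = int n * q i k" and perq: "\<And>i. periodic d (q i)"
    and c: "\<And>k. C_form n d F k = int n * (int n - 2) * c k" and perc: "periodic d c"
    and a0: "T_form n d F = int d * int n * (int n - 2) * a0"
  obtains X where "\<And>i. periodic d (X i)"
    and "\<And>i k. i \<in> {1..n} \<Longrightarrow> F i k = cover_laplacian n X i k"
proof -
  define s where "s k = (\<Sum>i=1..n. F i k)" for k
  define Q where "Q k = (\<Sum>i=4..n. q i k)" for k
  define a where "a k = a0 + c k" for k
  \<comment> \<open>As \<open>c 0 = 0\<close>, the constant is the one for which
    \<open>r k = (int n - 2) * a k - Q k - F 1 k\<close> holds at 0.\<close>
  define r where "r k = (int n - 2) * a0 - Q 0 - F 1 0 - cyclic_sum d s k" for k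
  \<comment> \<open>Row 1 minus row 3 expresses \<open>X 2 (k + 1) - X 2 k\<close> by
    \<open>a\<close>; adding the layer sum \<open>s k\<close> turns this into
    \<open>X 1 k - X 1 (k - 1)\<close>.\<close>
  define g where "g k = int n * a k + s k - (F 1 k - F 3 k)" for k
  define X where "X i k = (if i = 1 then cyclic_sum d g k
     else if i = 2 then cyclic_sum d g (k - 1) + r (k - 1)
     else if i = 3 then cyclic_sum d g k - a k
     else cyclic_sum d g k - a k + q i k)" for i k
  have per_s: "periodic d s" and per_a: "periodic d a" and per_g: "periodic d g"
    using per perc by (simp_all add: periodic_def s_def a_def g_def)
  have per_r: "periodic d r"
    using periodic_cyclic_sum[of d s] by (simp add: periodic_def r_def)
  have perX: "periodic d (X i)" for i
    using periodic_cyclic_sum[of d g] per_a perq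
      periodic_shift[OF periodic_cyclic_sum[of d g], of "-1"] periodic_shift[OF per_r, of "-1"]
    by (simp add: periodic_def X_def)
  have nz: "int n \<noteq> 0" "int n - 2 \<noteq> 0"
    using \<open>n \<ge> 4\<close> by auto
  have D_sum: "(\<Sum>i=4..n. F i k - F 3 k) = int n * Q k" for k
    unfolding Q_def sum_distrib_left by (intro sum.cong refl q)
  have sum_s: "(\<Sum>k<d. s (int k)) = 0"
    using zero by (simp add: s_def)
  have "int n * (Q k + F 1 k - Q 0 - F 1 0 - cyclic_sum d s k) = int n * ((int n - 2) * c k)" for k
    using c[of k] unfolding C_form_def D_sum s_def by (simp add: algebra_simps)
  then have "Q k + F 1 k - Q 0 - F 1 0 - cyclic_sum d s k = (int n - 2) * c k" for k
    using nz by simp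
  then have r: "r k = (int n - 2) * a k - Q k - F 1 k" for k
    by (simp add: r_def a_def algebra_simps)
  have rdiff: "r k - r (k - 1) = - s k" for k
    using cyclic_sum_diff[OF \<open>d > 0\<close> per_s sum_s, of k] by (simp add: r_def)
  \<comment> \<open>The condition on \<open>T_form\<close> enters here: it makes \<open>g\<close>
    sum to zero over a period, so that \<open>cyclic_sum d g\<close> has the increments
    \<open>g\<close> also across the end of the period.\<close>
  have "(int n - 2) * (E_form d F - int n * (\<Sum>k<d. c (int k))) = (int n - 2) * (int d * int n * a0)"
    using a0 unfolding T_form_def c sum_distrib_left[symmetric] by (simp add: algebra_simps)
  then have "E_form d F = int n * (\<Sum>k<d. c (int k)) + int d * int n * a0"
    using nz by simp
  then have sum_g: "(\<Sum>k<d. g (int k)) = 0"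
    using sum_s by (simp add: g_def a_def E_form_def sum.distrib sum_subtractf
        sum_distrib_left[symmetric] algebra_simps)
  have gdiff: "cyclic_sum d g (k - 1) = X 1 k - g k" for k
    using cyclic_sum_diff[OF \<open>d > 0\<close> per_g sum_g, of k] by (simp add: X_def)
  have X2: "X 2 k = X 1 k - 2 * a k - F 3 k - Q k" for k
  proof -
    have "X 2 k = X 1 k - g k + r k + s k"
      using gdiff[of k] rdiff[of k] by (simp add: X_def)
    then show ?thesis by (simp add: g_def r algebra_simps)
  qed
  have X2': "X 2 (k + 1) = X 1 k + r k" for k
    by (simp add: X_def)
  have X3: "X 3 k = X 1 k - a k" for k
    by (simp add: X_def)
  have X4: "X i k = X 3 k + q i k" if "i \<in> {4..n}" for i k
    using that by (simp add: X_def)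
  \<comment> \<open>Row 3 carries no correction, and every other row can then be compared with
    it.\<close>
  have S: "int n * X 3 k - (\<Sum>j=1..n. X j k) = F 3 k" for k
  proof -
    have "(\<Sum>i=4..n. X i k) = (\<Sum>i=4..n. X 3 k + q i k)"
      by (intro sum.cong refl X4)
    also have "\<dots> = (int n - 3) * X 3 k + Q k"
      using \<open>n \<ge> 4\<close> by (simp add: Q_def sum.distrib of_nat_diff)
    finally have "(\<Sum>j=1..n. X j k) = X 1 k + X 2 k + (int n - 2) * X 3 k + Q k"
      unfolding sum_1_n[OF \<open>n \<ge> 4\<close>] by (simp add: algebra_simps)
    then show ?thesis
      by (simp add: X2 X3 algebra_simps)
  qed
  have "F i k = cover_laplacian n X i k" if "i \<in> {1..n}" for i k
  proof -
    have *: "cover_laplacian n X i k = int n * (X i k - X 3 k) + F 3 k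
      - (if i = 1 then X 2 (k + 1) - X 2 k else if i = 2 then X 1 (k - 1) - X 1 k else 0)"
      using S[of k] by (simp add: cover_laplacian_def algebra_simps)
    have "i = 1 \<or> i = 2 \<or> i = 3 \<or> i \<in> {4..n}"
      using that by simp presburger
    then consider "i = 1" | "i = 2" | "i = 3" | "i \<in> {4..n}" by blast
    then show ?thesis
    proof cases
      case 1
      then show ?thesis
        unfolding * X2' by (simp add: X2 X3 r algebra_simps)
    next
      case 2
      \<comment> \<open>\<open>F 2\<close> enters the construction only through the layer sum
        \<open>s\<close>, so row 2 is recovered by expanding \<open>s\<close>.\<close>
      have "(\<Sum>i=4..n. F i k) = (int n - 3) * F 3 k + int n * Q k"
        using D_sum[of k] \<open>n \<ge> 4\<close> by (simp add: sum_subtractf of_nat_diff)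
      then have s: "s k = F 1 k + F 2 k + F 3 k + (int n - 3) * F 3 k + int n * Q k"
        unfolding s_def sum_1_n[OF \<open>n \<ge> 4\<close>] by simp
      have "X 1 (k - 1) - X 1 k = - g k"
        using gdiff[of k] by (simp add: X_def)
      then show ?thesis
        unfolding * using 2 by (simp add: X2 X3 g_def s algebra_simps)
    next
      case 3
      then show ?thesis unfolding * by simp
    next
      case 4
      then show ?thesis unfolding * using q[OF 4, of k] X4[OF 4, of k] by simp
    qed
  qed
  with perX show thesis using that by blast
qed

section \<open>Independent divisibility conditions\<close>

lemma C_form_0 [simp]: "C_form n d F 0 = 0"
  by (simp add: C_form_def)

lemma periodic_C_form:
  assumes "\<And>i. periodic d (F i)"
  shows "periodic d (C_form n d F)"
  using assms periodic_cyclic_sum[of d "\<lambda>k. \<Sum>i=1..n. F i k"]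
  by (simp add: periodic_def C_form_def)

lemma periodic_dvd:
  assumes "periodic d (g :: int \<Rightarrow> int)" and "d > 0" and "\<And>k. k < d \<Longrightarrow> m dvd g (int k)"
  shows "m dvd g k"
  using assms(3)[of "nat (k mod int d)"] \<open>d > 0\<close> periodic_mod[OF assms(1), of k]
  by (simp add: nat_less_iff)

text \<open>Constructing a solution takes divisibility of \<open>F i - F 3\<close> for all
  \<open>i >= 4\<close> and of \<open>C_form\<close> at all exponents; the conditions on the right
  imply these. \<open>C_form\<close> vanishes at 0, and its value at 1 is recovered from
  \<open>T_form\<close>, \<open>E_form\<close> and its other values, because \<open>T_form\<close>
  contains their sum.\<close>

lemma cover_laplacian_image_iff:
  assumes "n \<ge> 4" and "d \<ge> 2" and per: "\<And>i. periodic d (F i)"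
    and zero: "(\<Sum>k<d. \<Sum>i=1..n. F i (int k)) = 0"
  shows "(\<exists>X. (\<forall>i. periodic d (X i)) \<and> (\<forall>i\<in>{1..n}. \<forall>k. F i k = cover_laplacian n X i k)) \<longleftrightarrow>
    (\<forall>i\<in>{4..<n}. \<forall>k<d. int n dvd F i (int k) - F 3 (int k)) \<and> int n dvd F n 0 - F 3 0 \<and>
    int n dvd E_form d F \<and> (\<forall>k\<in>{2..<d}. int n * (int n - 2) dvd C_form n d F (int k)) \<and>
    int d * int n * (int n - 2) dvd T_form n d F"
    (is "?L \<longleftrightarrow> ?R")
proof
  assume ?L
  then obtain X where perX: "\<And>i. periodic d (X i)"
    and X: "\<forall>i\<in>{1..n}. \<forall>k. F i k = cover_laplacian n X i k"
    by blast
  have "d > 0" using \<open>d \<ge> 2\<close> by simp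
  note forms = cover_laplacian_forms[OF \<open>n \<ge> 4\<close> \<open>d > 0\<close> perX X]
  show ?R
    using \<open>n \<ge> 4\<close> by (auto simp: forms)
next
  assume R: ?R
  have "d > 0" using \<open>d \<ge> 2\<close> by simp
  have perD: "periodic d (\<lambda>k. F i k - F 3 k)" for i
    using per by (simp add: periodic_def)
  have "{..<d} = {0, 1} \<union> {2..<d}"
    using \<open>d \<ge> 2\<close> by auto
  then have "(\<Sum>k<d. C_form n d F (int k)) = C_form n d F 1 + (\<Sum>k=2..<d. C_form n d F (int k))"
    by (simp add: sum.union_disjoint)
  then have C1: "C_form n d F 1
      = (int n - 2) * E_form d F - T_form n d F - (\<Sum>k=2..<d. C_form n d F (int k))"
    by (simp add: T_form_def)
  have C_dvd': "int n * (int n - 2) dvd C_form n d F (int k)" if "k < d" for k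
  proof -
    consider "k = 0" | "k = 1" | "k \<in> {2..<d}" using \<open>k < d\<close> by fastforce
    then show ?thesis
    proof cases
      case 2
      have "int n * (int n - 2) dvd (int n - 2) * E_form d F"
        using R by (simp add: mult.commute mult_dvd_mono)
      moreover have "int n * (int n - 2) dvd T_form n d F"
        using R by (metis dvd_mult_right mult.assoc)
      moreover have "int n * (int n - 2) dvd (\<Sum>k=2..<d. C_form n d F (int k))"
        using R by (intro dvd_sum) auto
      ultimately show ?thesis
        using 2 C1 by simp
    qed (use R in auto)
  qed
  have C_dvd: "int n * (int n - 2) dvd C_form n d F k" for k
    by (rule periodic_dvd[OF periodic_C_form[OF per] \<open>d > 0\<close> C_dvd'])
  have D_dvd1: "int n dvd F i k - F 3 k" if "i \<in> {4..<n}" for i k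
    using periodic_dvd[OF perD \<open>d > 0\<close>, of "int n" i k] R that by blast
  \<comment> \<open>Modulo \<open>n\<close>, \<open>C_form\<close> at \<open>k\<close> is the sum over \<open>i \<ge> 4\<close> of \<open>F i - F 3\<close> at \<open>k\<close> minus that at 0,
    so the condition for \<open>i = n\<close> propagates from 0 to all \<open>k\<close>.\<close>
  have D_dvd: "int n dvd F i k - F 3 k" if "i \<in> {4..n}" for i k
  proof (cases "i = n")
    case True
    have "{4..n} = insert n {4..<n}" using \<open>n \<ge> 4\<close> by auto
    then have "C_form n d F k = (F n k - F 3 k) - (F n 0 - F 3 0)
       + (\<Sum>i=4..<n. F i k - F 3 k) - (\<Sum>i=4..<n. F i 0 - F 3 0)
       + int n * (F 1 k - F 1 0 - cyclic_sum d (\<lambda>k. \<Sum>i=1..n. F i k) k)"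
      by (simp add: C_form_def algebra_simps)
    then have "F n k - F 3 k = C_form n d F k + (F n 0 - F 3 0)
       - (\<Sum>i=4..<n. F i k - F 3 k) + (\<Sum>i=4..<n. F i 0 - F 3 0)
       - int n * (F 1 k - F 1 0 - cyclic_sum d (\<lambda>k. \<Sum>i=1..n. F i k) k)"
      by linarith
    also have "int n dvd \<dots>"
    proof (rule dvd_diff[OF dvd_add[OF dvd_diff[OF dvd_add]]])
      show "int n dvd C_form n d F k"
        using dvd_mult_left[OF C_dvd] .
      show "int n dvd F n 0 - F 3 0"
        using R by blast
    qed (auto intro: dvd_sum D_dvd1)
    finally show ?thesis using True by simp
  qed (use that D_dvd1 in auto)
  obtain a0 where a0: "T_form n d F = int d * int n * (int n - 2) * a0"
    using R unfolding dvd_def by blast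
  define q where "q i k = (F i k - F 3 k) div int n" for i k
  define c where "c k = C_form n d F k div (int n * (int n - 2))" for k
  show ?L
  proof (rule cover_laplacian_solution[OF \<open>n \<ge> 4\<close> \<open>d > 0\<close> per zero, of q c a0])
    show "F i k - F 3 k = int n * q i k" if "i \<in> {4..n}" for i k
      using D_dvd[OF that] by (simp add: q_def)
    show "periodic d (q i)" for i
      using per by (simp add: periodic_def q_def)
    show "C_form n d F k = int n * (int n - 2) * c k" for k
      using C_dvd by (simp add: c_def)
    show "periodic d c"
      using periodic_C_form[OF per, of n] by (simp add: periodic_def c_def)
  qed (use a0 in blast)+
qed

text \<open>The first block belongs to \<open>F i - F 3\<close> with \<open>4 <= i < n\<close> at
  all \<open>d\<close> exponents, to \<open>F n - F 3\<close> at 0 and to \<open>E_form\<close>; the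
  second to \<open>C_form\<close> at \<open>2, ..., d - 1\<close>; the last entry to
  \<open>T_form\<close>. In this order each modulus divides the next, so the list also serves as the
  list of invariant factors.\<close>

definition cover_moduli :: "nat \<Rightarrow> nat \<Rightarrow> nat list" where
  "cover_moduli n d =
     replicate ((n - 4) * d + 2) n @ replicate (d - 2) (n * (n - 2)) @ [d * n * (n - 2)]"

text \<open>\<open>C_form\<close> at \<open>k\<close> sits at offset \<open>k\<close> past the first
  \<open>(n - 4) * d\<close> entries. Offsets 0 and 1, where \<open>C_form\<close> gives no
  independent condition, hold the two remaining forms of modulus \<open>n\<close>.\<close>

definition cover_form :: "nat \<Rightarrow> nat \<Rightarrow> (nat \<Rightarrow> int \<Rightarrow> int) \<Rightarrow> nat \<Rightarrow> int" where
  "cover_form n d F j =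
     (if j < (n - 4) * d then F (4 + j div d) (int (j mod d)) - F 3 (int (j mod d))
      else if j = (n - 4) * d then F n 0 - F 3 0
      else if j = (n - 4) * d + 1 then E_form d F
      else if j < (n - 4) * d + d then C_form n d F (int (j - (n - 4) * d))
      else T_form n d F)"

lemma length_cover_moduli:
  assumes "n \<ge> 4" and "d \<ge> 2"
  shows "length (cover_moduli n d) = (n - 4) * d + d + 1"
  using assms by (simp add: cover_moduli_def)

lemma length_cover_moduli':
  assumes "n \<ge> 4" and "d \<ge> 2"
  shows "length (cover_moduli n d) = (n - 3) * d + 1"
proof -
  have "n - 3 = Suc (n - 4)" using assms by simp
  then show ?thesis using length_cover_moduli[OF assms] by simp
qed

lemma cover_form_dvd_iff:
  assumes "n \<ge> 4" and "d \<ge> 2"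
  shows "(\<forall>j<length (cover_moduli n d). int (cover_moduli n d ! j) dvd cover_form n d F j) \<longleftrightarrow>
    (\<forall>i\<in>{4..<n}. \<forall>k<d. int n dvd F i (int k) - F 3 (int k)) \<and> int n dvd F n 0 - F 3 0 \<and>
    int n dvd E_form d F \<and> (\<forall>k\<in>{2..<d}. int n * (int n - 2) dvd C_form n d F (int k)) \<and>
    int d * int n * (int n - 2) dvd T_form n d F"
    (is "?L \<longleftrightarrow> ?R")
proof -
  define a where "a = (n - 4) * d"
  have n2: "int (n - 2) = int n - 2" using \<open>n \<ge> 4\<close> by simp
  have nth: "cover_moduli n d ! j = (if j < a + 2 then n else if j < a + d then n * (n - 2) else d * n * (n - 2))"
    if "j < a + d + 1" for j
    using that \<open>d \<ge> 2\<close>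
    by (auto simp: cover_moduli_def a_def nth_append nth_Cons' simp del: add_2_eq_Suc add_2_eq_Suc')
  let ?P = "\<lambda>j. int (cover_moduli n d ! j) dvd cover_form n d F j"
  have "?L \<longleftrightarrow> (\<forall>j<a. ?P j) \<and> ?P a \<and> ?P (a + 1) \<and> (\<forall>k\<in>{2..<d}. ?P (a + k)) \<and> ?P (a + d)"
  proof -
    have "j < length (cover_moduli n d) \<longleftrightarrow>
        j < a \<or> j = a \<or> j = a + 1 \<or> (\<exists>k\<in>{2..<d}. j = a + k) \<or> j = a + d" for j
    proof -
      have "(\<exists>k\<in>{2..<d}. j = a + k) \<longleftrightarrow> a + 2 \<le> j \<and> j < a + d"
        by (auto intro!: bexI[of _ "j - a"])
      then show ?thesis
        using \<open>d \<ge> 2\<close> length_cover_moduli[OF assms] unfolding a_def[symmetric] by auto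
    qed
    then show ?thesis by auto
  qed
  moreover have "(\<forall>j<a. ?P j) \<longleftrightarrow> (\<forall>i\<in>{4..<n}. \<forall>k<d. int n dvd F i (int k) - F 3 (int k))"
  proof -
    have *: "?P j \<longleftrightarrow> int n dvd F (4 + j div d) (int (j mod d)) - F 3 (int (j mod d))" if "j < a" for j
      using that nth[of j] by (simp add: a_def cover_form_def)
    have "?P ((i - 4) * d + k) \<longleftrightarrow> int n dvd F i (int k) - F 3 (int k)"
      and "(i - 4) * d + k < a" if "i \<in> {4..<n}" "k < d" for i k
    proof -
      have "Suc (i - 4) * d \<le> (n - 4) * d"
        using that by (intro mult_le_mono1) auto
      then show lt: "(i - 4) * d + k < a"
        using that by (simp add: a_def)
      have "((i - 4) * d + k) div d = i - 4" "((i - 4) * d + k) mod d = k"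
        using that by auto
      then show "?P ((i - 4) * d + k) \<longleftrightarrow> int n dvd F i (int k) - F 3 (int k)"
        using *[OF lt] that by simp
    qed
    moreover have "4 + j div d \<in> {4..<n}" "j mod d < d" if "j < a" for j
      using that \<open>d \<ge> 2\<close> by (auto simp: a_def less_mult_imp_div_less less_diff_conv
          dest!: less_mult_imp_div_less)
    ultimately show ?thesis
      using * by (metis (no_types, lifting))
  qed
  moreover have "?P a \<longleftrightarrow> int n dvd F n 0 - F 3 0"
    using nth[of a] by (simp add: a_def cover_form_def)
  moreover have "?P (a + 1) \<longleftrightarrow> int n dvd E_form d F"
    using nth[of "a + 1"] \<open>d \<ge> 2\<close> by (simp add: a_def cover_form_def)
  moreover have "?P (a + k) \<longleftrightarrow> int n * (int n - 2) dvd C_form n d F (int k)" if "k \<in> {2..<d}" for k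
    using that n2 nth[of "a + k"] by (auto simp: a_def cover_form_def)
  moreover have "?P (a + d) \<longleftrightarrow> int d * int n * (int n - 2) dvd T_form n d F"
    using \<open>d \<ge> 2\<close> n2 nth[of "a + d"] by (simp add: a_def cover_form_def)
  ultimately show ?thesis by blast
qed

text \<open>The choice is triangular: \<open>F 3\<close> is zero, \<open>F 1\<close> is supported at
  exponent 0 and fixes \<open>E_form\<close>, rows \<open>4 <= i < n\<close> are the prescribed
  differences, and \<open>F n\<close> is solved from \<open>C_form\<close>. \<open>F 2\<close> makes
  every layer sum to zero, so that the \<open>cyclic_sum\<close> term drops out.\<close>

lemma cover_form_surj:
  assumes "n \<ge> 4" and "d \<ge> 2"
  obtains F where "\<And>i. periodic d (F i)" and "\<And>i k. i \<notin> {1..n} \<Longrightarrow> F i k = 0"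
    and "\<And>k. (\<Sum>i=1..n. F i k) = 0"
    and "\<And>j. j < length (cover_moduli n d) \<Longrightarrow> cover_form n d F j = y j"
proof -
  define a where "a = (n - 4) * d"
  define e where "e = y (a + 1)"
  \<comment> \<open>The value at 1 is the one for which \<open>(int n - 2) * e\<close> minus the sum
    of \<open>c\<close> over a period equals \<open>y (a + d)\<close>, the value prescribed for
    \<open>T_form\<close>.\<close>
  define c where "c k = (if k mod int d = 0 then 0
    else if k mod int d = 1 then (int n - 2) * e - y (a + d) - (\<Sum>j=2..<d. y (a + j))
    else y (a + nat (k mod int d)))" for k
  define D where "D i k = y ((i - 4) * d + nat (k mod int d))" for i k
  define F1 where "F1 k = (if k mod int d = 0 then e else 0)" for k
  \<comment> \<open>This solves \<open>C_form n d F k = c k\<close> for row \<open>n\<close>, with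
    \<open>Fn 0 = y a\<close>.\<close>
  define Fn where "Fn k = c k - (\<Sum>i=4..<n. D i k) + (\<Sum>i=4..<n. D i 0) + int n * e - int n * F1 k + y a"
    for k
  define F where "F i k = (if i = 1 then F1 k
    else if i = 2 then - F1 k - (\<Sum>i=4..<n. D i k) - Fn k
    else if i \<in> {4..<n} then D i k else if i = n then Fn k else 0)" for i k
  have F_simps: "F 1 k = F1 k" "F 2 k = - F1 k - (\<Sum>i=4..<n. D i k) - Fn k" "F 3 k = 0"
    "F n k = Fn k" "i \<in> {4..<n} \<Longrightarrow> F i k = D i k" for i k
    using \<open>n \<ge> 4\<close> by (auto simp: F_def)
  have outside: "F i k = 0" if "i \<notin> {1..n}" for i k
    using that \<open>n \<ge> 4\<close> by (auto simp: F_def)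
  have D_sum: "(\<Sum>i=4..n. F i k) = (\<Sum>i=4..<n. D i k) + Fn k" for k
  proof -
    have "{4..n} = insert n {4..<n}" using \<open>n \<ge> 4\<close> by auto
    moreover have "(\<Sum>i=4..<n. F i k) = (\<Sum>i=4..<n. D i k)"
      by (intro sum.cong refl F_simps)
    ultimately show ?thesis by (simp add: F_simps)
  qed
  have zero: "(\<Sum>i=1..n. F i k) = 0" for k
    unfolding sum_1_n[OF \<open>n \<ge> 4\<close>] D_sum F_simps by simp
  have per: "periodic d (F i)" for i
    by (auto simp: periodic_def F_def F1_def Fn_def D_def c_def)
  have init: "Fn 0 = y a" "F1 0 = e"
    by (simp_all add: Fn_def F1_def c_def)
  have C: "C_form n d F k = c k" for k
    unfolding C_form_def zero cyclic_sum_def F_simps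
    by (simp add: D_sum init) (simp add: Fn_def)
  have E: "E_form d F = e"
  proof -
    have "E_form d F = (\<Sum>k<d. if k = 0 then e else 0)"
      unfolding E_form_def F_simps F1_def by (intro sum.cong) auto
    then show ?thesis using \<open>d \<ge> 2\<close> by simp
  qed
  have c_large: "c (int k) = y (a + k)" if "k \<in> {2..<d}" for k
    using that by (simp add: c_def)
  have "{..<d} = {0, 1} \<union> {2..<d}"
    using \<open>d \<ge> 2\<close> by auto
  then have "(\<Sum>k<d. c (int k)) = c 0 + c 1 + (\<Sum>k=2..<d. c (int k))"
    by (simp add: sum.union_disjoint)
  also have "(\<Sum>k=2..<d. c (int k)) = (\<Sum>k=2..<d. y (a + k))"
    by (intro sum.cong refl c_large)
  finally have T: "T_form n d F = y (a + d)"
    using \<open>d \<ge> 2\<close> unfolding T_form_def C E by (simp add: c_def)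
  have "cover_form n d F j = y j" if j: "j < length (cover_moduli n d)" for j
  proof -
    consider "j < a" | "j = a" | "j = a + 1" | k where "k \<in> {2..<d}" "j = a + k" | "j = a + d"
    proof -
      have "j < a \<or> j = a \<or> j = a + 1 \<or> (j - a \<in> {2..<d} \<and> j = a + (j - a)) \<or> j = a + d"
        using j length_cover_moduli[OF assms] unfolding a_def[symmetric] by auto
      then show thesis using that by blast
    qed
    then show ?thesis
    proof cases
      case 1
      then have "4 + j div d \<in> {4..<n}"
        by (auto simp: a_def less_diff_conv dest!: less_mult_imp_div_less)
      then have "F (4 + j div d) (int (j mod d)) = y j"
        by (simp add: F_simps D_def flip: of_nat_mod)
      then show ?thesis
        using 1 by (simp add: cover_form_def a_def F_simps)
    next
      case (4 k)
      then show ?thesis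
        using C[of "int k"] c_large[of k] by (simp add: cover_form_def a_def)
    qed (use \<open>d \<ge> 2\<close> in \<open>auto simp: cover_form_def a_def[symmetric] F_simps init E T e_def\<close>)
  qed
  with per outside zero that show thesis by blast
qed

lemma cover_form_add:
  "cover_form n d (\<lambda>i k. F i k + F' i k) j = cover_form n d F j + cover_form n d F' j"
proof -
  have E: "E_form d (\<lambda>i k. F i k + F' i k) = E_form d F + E_form d F'"
    by (simp add: E_form_def sum.distrib sum_subtractf)
  have C: "C_form n d (\<lambda>i k. F i k + F' i k) k = C_form n d F k + C_form n d F' k" for k
    by (simp add: C_form_def cyclic_sum_add sum.distrib sum_subtractf algebra_simps)
  have "T_form n d (\<lambda>i k. F i k + F' i k) = T_form n d F + T_form n d F'"
    by (simp add: T_form_def E C sum.distrib algebra_simps)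
  then show ?thesis
    by (simp add: cover_form_def E C)
qed

section \<open>Finite products of cyclic groups\<close>

abbreviation cyclic_product :: "nat list \<Rightarrow> (nat \<Rightarrow> int) monoid" where
  "cyclic_product ms \<equiv> product_group {..<length ms} (\<lambda>i. integer_mod_group (ms ! i))"

lemma order_iso: "G \<cong> H \<Longrightarrow> order G = order H"
  by (auto simp: is_iso_def iso_def order_def dest: bij_betw_same_card)

lemma group_int_matrix_coker: "group (int_matrix_coker I J M)"
proof -
  have "comm_group (free_int_module I)"
    by (intro group.group_comm_groupI) auto
  then interpret comm_group "free_int_module I" .
  have "int_matrix_image I J M \<lhd> free_int_module I"
    by (rule subgroup_imp_normal[OF subgroup_int_matrix_image])
  then show ?thesis
    unfolding int_matrix_coker_def by (rule normal.factorgroup_is_group)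
qed

text \<open>Reducing each form by its modulus gives a surjective homomorphism onto the product, and
  its kernel is the matrix image; the first isomorphism theorem does the rest.\<close>

lemma int_matrix_coker_iso_cyclic_product:
  assumes pos: "0 \<notin> set ms"
    and add: "\<And>f g j. f \<in> carrier (free_int_module I) \<Longrightarrow> g \<in> carrier (free_int_module I) \<Longrightarrow>
      \<phi> (\<lambda>i\<in>I. f i + g i) j = \<phi> f j + \<phi> g j"
    and surj: "\<And>y. \<exists>f\<in>carrier (free_int_module I). \<forall>j<length ms. \<phi> f j = y j"
    and image: "\<And>f. f \<in> carrier (free_int_module I) \<Longrightarrow>
      f \<in> int_matrix_image I J M \<longleftrightarrow> (\<forall>j<length ms. int (ms ! j) dvd \<phi> f j)"
  shows "int_matrix_coker I J M \<cong> cyclic_product ms"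
proof -
  define \<theta> where "\<theta> f = (\<lambda>j\<in>{..<length ms}. \<phi> f j mod int (ms ! j))" for f
  have nz: "ms ! j \<noteq> 0" if "j < length ms" for j
    using pos nth_mem[OF that] by metis
  have closed: "\<theta> f \<in> carrier (cyclic_product ms)" for f
    using nz by (auto simp: \<theta>_def carrier_integer_mod_group)
  have "\<theta> \<in> hom (free_int_module I) (cyclic_product ms)"
  proof (rule homI)
    fix f g assume "f \<in> carrier (free_int_module I)" "g \<in> carrier (free_int_module I)"
    then show "\<theta> (f \<otimes>\<^bsub>free_int_module I\<^esub> g) = \<theta> f \<otimes>\<^bsub>cyclic_product ms\<^esub> \<theta> g"
      using add[of f g] by (auto simp: \<theta>_def mod_add_eq)
  qed (rule closed)
  then interpret group_hom "free_int_module I" "cyclic_product ms" \<theta>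
    by (intro group_hom.intro group_hom_axioms.intro) auto
  have "\<theta> ` carrier (free_int_module I) = carrier (cyclic_product ms)"
  proof (intro equalityI subsetI)
    fix y assume y: "y \<in> carrier (cyclic_product ms)"
    from surj[of y] obtain f where f: "f \<in> carrier (free_int_module I)"
      and fy: "\<forall>j<length ms. \<phi> f j = y j" by blast
    have "\<theta> f = y"
    proof
      fix j
      show "\<theta> f j = y j"
      proof (cases "j < length ms")
        case True
        then have "y j \<in> carrier (integer_mod_group (ms ! j))"
          using y by auto
        then show ?thesis
          using True fy nz[OF True] by (simp add: \<theta>_def carrier_integer_mod_group)
      next
        case False
        then show ?thesis using y by (auto simp: \<theta>_def PiE_def extensional_def)
      qed
    qed
    with f show "y \<in> \<theta> ` carrier (free_int_module I)" by blast
  qed (use closed in blast)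
  then have "free_int_module I Mod kernel (free_int_module I) (cyclic_product ms) \<theta> \<cong> cyclic_product ms"
    by (rule FactGroup_iso)
  moreover have "kernel (free_int_module I) (cyclic_product ms) \<theta> = int_matrix_image I J M"
  proof -
    have "\<theta> f = \<one>\<^bsub>cyclic_product ms\<^esub> \<longleftrightarrow> (\<forall>j<length ms. int (ms ! j) dvd \<phi> f j)" for f
      by (auto simp: \<theta>_def fun_eq_iff restrict_def)
    then show ?thesis
      using image subgroup.subset[OF subgroup_int_matrix_image[of I J M]] by (auto simp: kernel_def)
  qed
  ultimately show ?thesis
    by (simp add: int_matrix_coker_def)
qed

lemma product_group_cong:
  assumes "\<And>i. i \<in> I \<Longrightarrow> G i = H i"
  shows "product_group I G = product_group I H"
  using assms by (auto simp: product_group_def fun_eq_iff restrict_def intro!: PiE_cong)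

lemma cyclic_product_replicate: "cyclic_product (replicate k m) = cyclic_power m k"
  unfolding cyclic_power_def length_replicate by (rule product_group_cong) simp

lemma cyclic_product_singleton: "cyclic_product [m] \<cong> integer_mod_group m"
proof (rule is_isoI)
  show "(\<lambda>x. x 0) \<in> iso (cyclic_product [m]) (integer_mod_group m)"
  proof (rule isoI)
    show "bij_betw (\<lambda>x. x 0) (carrier (cyclic_product [m])) (carrier (integer_mod_group m))"
      by (rule bij_betw_byWitness[where f' = "\<lambda>x. \<lambda>i\<in>{..<1}. x"])
        (auto simp: fun_eq_iff PiE_def extensional_def Pi_iff)
  qed (auto intro!: homI simp: PiE_iff)
qed

lemma cyclic_product_append:
  "cyclic_product (xs @ ys) \<cong> cyclic_product xs \<times>\<times> cyclic_product ys"
proof (rule is_isoI)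
  let ?f = "\<lambda>x. (\<lambda>i\<in>{..<length xs}. x i, \<lambda>i\<in>{..<length ys}. x (length xs + i))"
  let ?g = "\<lambda>(u, v). \<lambda>i\<in>{..<length (xs @ ys)}. if i < length xs then u i else v (i - length xs)"
  show "?f \<in> iso (cyclic_product (xs @ ys)) (cyclic_product xs \<times>\<times> cyclic_product ys)"
  proof (rule isoI)
    show "?f \<in> hom (cyclic_product (xs @ ys)) (cyclic_product xs \<times>\<times> cyclic_product ys)"
    proof (rule homI)
      fix x assume "x \<in> carrier (cyclic_product (xs @ ys))"
      then have x: "x i \<in> carrier (integer_mod_group ((xs @ ys) ! i))" if "i < length (xs @ ys)" for i
        using that by (auto simp: PiE_iff)
      have "x i \<in> carrier (integer_mod_group (xs ! i))" if "i < length xs" for i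
        using x[of i] that by (simp add: nth_append)
      moreover have "x (length xs + i) \<in> carrier (integer_mod_group (ys ! i))" if "i < length ys" for i
        using x[of "length xs + i"] that by simp
      ultimately show "?f x \<in> carrier (cyclic_product xs \<times>\<times> cyclic_product ys)"
        by auto
      show "?f (x \<otimes>\<^bsub>cyclic_product (xs @ ys)\<^esub> y) =
          ?f x \<otimes>\<^bsub>cyclic_product xs \<times>\<times> cyclic_product ys\<^esub> ?f y" for y
        by (simp add: fun_eq_iff nth_append)
    qed
    show "bij_betw ?f (carrier (cyclic_product (xs @ ys))) (carrier (cyclic_product xs \<times>\<times> cyclic_product ys))"
    proof (rule bij_betw_byWitness[where f' = ?g])
      show "\<forall>x\<in>carrier (cyclic_product (xs @ ys)). ?g (?f x) = x"
        by (auto simp: fun_eq_iff PiE_def extensional_def)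
      show "\<forall>y\<in>carrier (cyclic_product xs \<times>\<times> cyclic_product ys). ?f (?g y) = y"
        by (auto simp: fun_eq_iff PiE_def extensional_def)
      show "?f ` carrier (cyclic_product (xs @ ys)) \<subseteq> carrier (cyclic_product xs \<times>\<times> cyclic_product ys)"
        using \<open>?f \<in> hom _ _\<close> by (auto simp only: hom_def)
      show "?g ` carrier (cyclic_product xs \<times>\<times> cyclic_product ys) \<subseteq> carrier (cyclic_product (xs @ ys))"
        by (auto simp: nth_append PiE_iff less_diff_conv2)
    qed
  qed
qed

lemma order_cyclic_product:
  assumes "0 \<notin> set ms"
  shows "order (cyclic_product ms) = prod_list ms"
proof -
  have "card (carrier (integer_mod_group (ms ! i))) = ms ! i" if "i < length ms" for i
    using assms nth_mem[OF that] by (auto simp: carrier_integer_mod_group)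
  then show ?thesis
    by (simp add: order_def card_PiE prod.list_conv_set_nth atLeast0LessThan)
qed

section \<open>Generating sets and the number of invariant factors\<close>

lemma generate_unit_vectors:
  assumes gt: "\<forall>m\<in>set ms. m > 1"
  shows "generate (cyclic_product ms)
    ((\<lambda>i. \<lambda>j\<in>{..<length ms}. if j = i then 1 else 0) ` {..<length ms}) = carrier (cyclic_product ms)"
    (is "generate ?P ?E = _")
proof
  interpret P: group ?P by simp
  have gt': "ms ! j > 1" if "j < length ms" for j
    using gt that by simp
  have E: "?E \<subseteq> carrier ?P"
    using gt' by (fastforce simp: carrier_integer_mod_group PiE_iff)
  then show "generate ?P ?E \<subseteq> carrier ?P"
    by (rule P.generate_incl)
  show "carrier ?P \<subseteq> generate ?P ?E"
  proof
    fix x assume "x \<in> carrier ?P"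
    then show "x \<in> generate ?P ?E"
    \<comment> \<open>Coordinates are least residues, so their sum drops when a unit vector is
      subtracted at a positive coordinate, with no wrap-around.\<close>
    proof (induction "\<Sum>j<length ms. nat (x j)" arbitrary: x rule: less_induct)
      case less
      have x: "0 \<le> x j" "x j < int (ms ! j)" if "j < length ms" for j
      proof -
        have "x j \<in> carrier (integer_mod_group (ms ! j))"
          using less.prems that by (auto simp: PiE_iff)
        then show "0 \<le> x j" "x j < int (ms ! j)"
          using gt'[OF that] by (auto simp: carrier_integer_mod_group)
      qed
      have ext: "x \<in> extensional {..<length ms}"
        using less.prems by (auto simp: PiE_def)
      show ?case
      proof (cases "\<forall>j<length ms. x j = 0")
        case True
        then have "x = \<one>\<^bsub>?P\<^esub>"
          using ext by (auto simp: fun_eq_iff extensional_def)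
        then show ?thesis using generate.one by metis
      next
        case False
        then obtain i where i: "i < length ms" "x i > 0"
          using x by (metis less_le)
        let ?e = "\<lambda>j\<in>{..<length ms}. if j = i then 1 else 0 :: int"
        have "(\<Sum>j<length ms. nat ((x(i := x i - 1)) j)) < (\<Sum>j<length ms. nat (x j))"
          using i by (intro sum_strict_mono_ex1) auto
        moreover have "x(i := x i - 1) \<in> carrier ?P"
        proof -
          have "(x(i := x i - 1)) j \<in> carrier (integer_mod_group (ms ! j))" if "j < length ms" for j
            using x[OF that] gt'[OF that] i by (auto simp: carrier_integer_mod_group)
          then show ?thesis
            using ext i by (auto simp: PiE_def extensional_def)
        qed
        ultimately have "x(i := x i - 1) \<in> generate ?P ?E"
          by (rule less.hyps)
        moreover have "?e \<in> generate ?P ?E"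
          using i by (intro generate.incl) auto
        ultimately have "x(i := x i - 1) \<otimes>\<^bsub>?P\<^esub> ?e \<in> generate ?P ?E"
          by (rule generate.eng)
        also have "x(i := x i - 1) \<otimes>\<^bsub>?P\<^esub> ?e = x"
          using x ext i by (auto simp: fun_eq_iff extensional_def)
        finally show ?thesis .
      qed
    qed
  qed
qed

text \<open>
  The \<open>p ^ length ms\<close> characters \<open>h c\<close> with values modulo \<open>p\<close> are determined by their restrictions to
  a generating set \<open>S\<close>, and there are only \<open>p ^ card S\<close> maps on \<open>S\<close>.
\<close>

lemma card_generators_cyclic_product_ge:
  assumes "prime p" and p: "\<forall>m\<in>set ms. p dvd m \<and> m > 0"
    and S: "S \<subseteq> carrier (cyclic_product ms)" "finite S"
      "generate (cyclic_product ms) S = carrier (cyclic_product ms)"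
  shows "length ms \<le> card S"
proof -
  let ?P = "cyclic_product ms" and ?N = "{..<length ms}"
  interpret P: group ?P by simp
  have p1: "p > 1" using \<open>prime p\<close> by (rule prime_gt_1_nat)
  have p': "p dvd ms ! j" "ms ! j > 0" if "j < length ms" for j
    using p that by auto
  \<comment> \<open>Since \<open>p\<close> divides every modulus, reduction modulo \<open>p\<close>
    respects the addition of each factor; this makes every \<open>h c\<close> a character.\<close>
  have mod_p: "(x mod int (ms ! j)) mod int p = x mod int p" if "j < length ms" for x j
    using p'[OF that] by (simp add: mod_mod_cancel)
  define h where "h c x = (\<Sum>j\<in>?N. c j * x j) mod int p" for c x :: "nat \<Rightarrow> int"
  have h_mult: "h c (x \<otimes>\<^bsub>?P\<^esub> y) = (h c x + h c y) mod int p" for c x y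
  proof -
    have "h c (x \<otimes>\<^bsub>?P\<^esub> y) = (\<Sum>j\<in>?N. c j * ((x j + y j) mod int (ms ! j)) mod int p) mod int p"
      by (simp add: h_def mod_sum_eq)
    also have "\<dots> = (\<Sum>j\<in>?N. c j * (x j + y j) mod int p) mod int p"
    proof -
      have "c j * ((x j + y j) mod int (ms ! j)) mod int p = c j * (x j + y j) mod int p" if "j \<in> ?N" for j
        using mod_p[of j "x j + y j"] that by (metis lessThan_iff mod_mult_right_eq)
      then have "(\<Sum>j\<in>?N. c j * ((x j + y j) mod int (ms ! j)) mod int p)
          = (\<Sum>j\<in>?N. c j * (x j + y j) mod int p)"
        by (rule sum.cong[OF refl])
      then show ?thesis by simp
    qed
    also have "\<dots> = (h c x + h c y) mod int p"
      by (simp add: h_def mod_sum_eq distrib_left sum.distrib mod_add_eq)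
    finally show ?thesis .
  qed
  have "inj_on (\<lambda>c. \<lambda>s\<in>S. h c s) (?N \<rightarrow>\<^sub>E {0..<int p})"
  proof (rule inj_onI)
    fix c c' assume c: "c \<in> ?N \<rightarrow>\<^sub>E {0..<int p}" and c': "c' \<in> ?N \<rightarrow>\<^sub>E {0..<int p}"
      and eq: "(\<lambda>s\<in>S. h c s) = (\<lambda>s\<in>S. h c' s)"
    have eqS: "h c s = h c' s" if "s \<in> S" for s
      using eq that by (metis restrict_apply')
    have one: "h b \<one>\<^bsub>?P\<^esub> = 0" for b
      by (simp add: h_def)
    \<comment> \<open>Additivity determines the value at an inverse, which serves the inverse case
      of the induction over \<open>generate\<close>.\<close>
    have inv_eq: "h b (inv\<^bsub>?P\<^esub> x) = (- h b x) mod int p" if "x \<in> carrier ?P" for b x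
    proof -
      have "(h b (inv\<^bsub>?P\<^esub> x) + h b x) mod int p = 0"
        using h_mult[of b "inv\<^bsub>?P\<^esub> x" x] that P.l_inv[OF that] one[of b] by simp
      then have "(h b (inv\<^bsub>?P\<^esub> x) + h b x - h b x) mod int p = (0 - h b x) mod int p"
        by (metis mod_diff_left_eq mod_0)
      then show ?thesis by (simp add: h_def)
    qed
    have "h c x = h c' x" if "x \<in> generate ?P S" for x
      using that
    proof (induction x rule: generate.induct)
      case (inv s)
      then have "s \<in> carrier ?P"
        using S(1) by blast
      then show ?case
        using eqS[OF inv] by (simp only: inv_eq)
    next
      case (eng x y)
      then show ?case by (simp only: h_mult)
    qed (simp_all only: one eqS)
    then have all: "h c x = h c' x" if "x \<in> carrier ?P" for x
      using that S(3) by blast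
    show "c = c'"
    proof
      fix i
      show "c i = c' i"
      proof (cases "i < length ms")
        case True
        \<comment> \<open>Evaluation at the unit vectors recovers the coefficients of a
          character.\<close>
        let ?e = "\<lambda>j\<in>?N. if j = i then 1 else 0 :: int"
        have "ms ! j > 1" if "j < length ms" for j
          using p'[OF that] p1 by (metis dvd_imp_le less_le_trans)
        then have "?e \<in> carrier ?P"
          by (fastforce simp: carrier_integer_mod_group PiE_iff)
        moreover have "h b ?e = b i mod int p" for b
        proof -
          have "(\<Sum>j\<in>?N. b j * ?e j) = (\<Sum>j\<in>?N. if j = i then b j else 0)"
            by (intro sum.cong) auto
          then show ?thesis using True by (simp add: h_def)
        qed
        ultimately have "c i mod int p = c' i mod int p"
          using all[of ?e] by simp
        moreover have "c i \<in> {0..<int p}" "c' i \<in> {0..<int p}"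
          using c c' True by (auto simp: PiE_iff)
        ultimately show ?thesis by simp
      qed (use c c' in \<open>auto simp: PiE_def extensional_def\<close>)
    qed
  qed
  moreover have "(\<lambda>c. \<lambda>s\<in>S. h c s) ` (?N \<rightarrow>\<^sub>E {0..<int p}) \<subseteq> S \<rightarrow>\<^sub>E {0..<int p}"
    using p1 by (intro image_subsetI restrict_PiE_iff[THEN iffD2] ballI) (simp add: h_def)
  moreover have "finite (S \<rightarrow>\<^sub>E {0..<int p})"
    using \<open>finite S\<close> by (rule finite_PiE) simp
  ultimately have "card (?N \<rightarrow>\<^sub>E {0..<int p}) \<le> card (S \<rightarrow>\<^sub>E {0..<int p})"
    by (rule card_inj_on_le)
  then have "p ^ length ms \<le> p ^ card S"
    using \<open>finite S\<close> by (simp add: card_PiE)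
  then show ?thesis
    using p1 by simp
qed

text \<open>The unit vectors give the upper bound. For the lower bound, a prime factor of the first
  modulus divides all of them along the divisibility chain, so the character count applies.\<close>

lemma min_generators_cyclic_product:
  assumes gt: "\<forall>m\<in>set ms. m > 1" and succ: "successively (dvd) ms"
  shows "min_generators (cyclic_product ms) = length ms"
  unfolding min_generators_def
proof (rule Least_equality)
  let ?e = "\<lambda>i. \<lambda>j\<in>{..<length ms}. if j = i then 1 else 0 :: int"
  let ?E = "?e ` {..<length ms}"
  have "inj_on ?e {..<length ms}"
  proof (rule inj_onI)
    fix i j assume "i \<in> {..<length ms}" "j \<in> {..<length ms}" "?e i = ?e j"
    then have "?e i i = ?e j i" by metis
    then show "i = j"
      using \<open>i \<in> {..<length ms}\<close> by (simp split: if_splits)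
  qed
  then have "card ?E = length ms"
    by (simp add: card_image)
  then show "\<exists>S\<subseteq>carrier (cyclic_product ms). finite S \<and> card S = length ms \<and>
      generate (cyclic_product ms) S = carrier (cyclic_product ms)"
    using generate_unit_vectors[OF gt] generate.incl[of _ ?E "cyclic_product ms"]
    by (intro exI[of _ ?E]) blast
next
  fix k assume "\<exists>S\<subseteq>carrier (cyclic_product ms). finite S \<and> card S = k \<and>
      generate (cyclic_product ms) S = carrier (cyclic_product ms)"
  then obtain S where S: "S \<subseteq> carrier (cyclic_product ms)" "finite S"
    "generate (cyclic_product ms) S = carrier (cyclic_product ms)" and k: "card S = k" by blast
  show "length ms \<le> k"
  proof (cases ms)
    case (Cons m ms')
    then have "m \<noteq> 1" using gt by auto
    then obtain p where "prime p" "p dvd m"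
      using prime_factor_nat by blast
    have "sorted_wrt (dvd) ms"
      using succ by (subst (asm) successively_iff_sorted_wrt_strong) (auto simp: transp_def intro: dvd_trans)
    then have "\<forall>m'\<in>set ms. p dvd m' \<and> m' > 0"
      using Cons \<open>p dvd m\<close> gt by (auto intro: dvd_trans)
    from card_generators_cyclic_product_ge[OF \<open>prime p\<close> this S] show ?thesis
      using k by simp
  qed simp
qed

lemma min_generators_iso:
  assumes "group A" and "group B" and "A \<cong> B"
  shows "min_generators A = min_generators B"
proof -
  \<comment> \<open>Fresh type variables let the same fact serve both directions of the
    isomorphism.\<close>
  have *: "\<exists>T\<subseteq>carrier B. finite T \<and> card T = k \<and> generate B T = carrier B"
    if "group A" "group B" "A \<cong> B" and "\<exists>S\<subseteq>carrier A. finite S \<and> card S = k \<and> generate A S = carrier A"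
    for A :: "('x, 'y) monoid_scheme" and B :: "('u, 'v) monoid_scheme" and k
  proof -
    from that obtain f where f: "f \<in> iso A B" by (auto simp: is_iso_def)
    interpret group_hom A B f
      using that f by (intro group_hom.intro group_hom_axioms.intro) (auto simp: iso_def)
    have bij: "inj_on f (carrier A)" "f ` carrier A = carrier B"
      using f by (auto simp: iso_def bij_betw_def)
    from that obtain S where S: "S \<subseteq> carrier A" "finite S" "card S = k" "generate A S = carrier A" by blast
    have "generate B (f ` S) = carrier B"
      using generate_img[OF S(1)] S(4) bij by simp
    moreover have "card (f ` S) = k"
      using S bij by (metis card_image inj_on_subset)
    ultimately show ?thesis
      using S by (intro exI[of _ "f ` S"]) auto
  qed
  have "(\<exists>S\<subseteq>carrier A. finite S \<and> card S = k \<and> generate A S = carrier A) \<longleftrightarrow>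
      (\<exists>S\<subseteq>carrier B. finite S \<and> card S = k \<and> generate B S = carrier B)" for k
    by (rule iffI) (rule *[OF assms] *[OF assms(2,1) group.iso_sym[OF assms(1,3)]], assumption)+
  then show ?thesis
    by (simp add: min_generators_def)
qed

lemma min_generators_invariant_factors:
  assumes "group A" and "invariant_factors A ms"
  shows "min_generators A = length ms"
  using assms min_generators_iso[of A "cyclic_product ms"] min_generators_cyclic_product[of ms]
  by (simp add: invariant_factors_def)

text \<open>Every list of invariant factors has length \<open>min_generators A\<close>, so the
  definite description is unambiguous; the uniqueness half of the structure theorem is
  bypassed.\<close>

lemma num_invariant_factors_eq:
  assumes "group A" and "invariant_factors A ms"
  shows "num_invariant_factors A = length ms"
  unfolding num_invariant_factors_def
  using assms min_generators_invariant_factors[OF assms(1)] by (intro the_equality) metis+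

section \<open>The Jacobian of the single voltage cover\<close>

locale cyclic_cover = group G for G (structure) +
  fixes \<tau> :: 'a and n d :: nat
  assumes tau: "\<tau> \<in> carrier G" and gen: "generate G {\<tau>} = carrier G"
    and order_eq: "order G = d" and n4: "n \<ge> 4" and d2: "d \<ge> 2"
begin

abbreviation Y :: "(nat \<times> 'a) pair_pre_digraph" where
  "Y \<equiv> single_voltage_cover n G \<tau>"

abbreviation V :: "(nat \<times> 'a) set" where
  "V \<equiv> {1..n} \<times> carrier G"

definition along :: "(nat \<times> 'a \<Rightarrow> int) \<Rightarrow> nat \<Rightarrow> int \<Rightarrow> int" where
  "along x i k = x (i, \<tau> [^] k)"

text \<open>Only the class modulo \<open>d\<close> of the chosen exponent is determined, which is
  enough because \<open>dlog\<close> is fed to periodic functions.\<close>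

definition dlog :: "'a \<Rightarrow> int" where
  "dlog g = (SOME k. \<tau> [^] k = g)"

lemma d_pos: "d > 0"
  using d2 by simp

lemma pverts_Y: "pverts Y = V"
  by (simp add: single_voltage_cover_def derived_graph_def complete_pair_graph_def)

lemma finite_carrier: "finite (carrier G)"
  using d_pos order_eq by (metis card.infinite less_numeral_extra(3) order_def)

lemma finite_V: "finite V"
  using finite_carrier by simp

lemma ord_tau: "ord \<tau> = d"
  using generate_pow_card[OF tau] gen order_eq by (simp add: order_def)

lemma pow_eq_iff: "\<tau> [^] (k::int) = \<tau> [^] (l::int) \<longleftrightarrow> k mod int d = l mod int d"
  using int_pow_eq[OF tau, of k l] ord_tau by (simp add: mod_eq_dvd_iff dvd_diff_commute)

lemma carrier_pow: "g \<in> carrier G \<longleftrightarrow> (\<exists>k::int. g = \<tau> [^] k)"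
  using generate_pow[OF tau] gen by auto

lemma pow_dlog: "g \<in> carrier G \<Longrightarrow> \<tau> [^] dlog g = g"
  unfolding dlog_def by (rule someI_ex) (metis carrier_pow)

lemma bij_pow: "bij_betw (\<lambda>k. \<tau> [^] int k) {..<d} (carrier G)"
proof (rule bij_betw_imageI)
  show "inj_on (\<lambda>k. \<tau> [^] int k) {..<d}"
    by (auto simp: inj_on_def pow_eq_iff)
  then show "(\<lambda>k. \<tau> [^] int k) ` {..<d} = carrier G"
    using order_eq finite_carrier tau by (intro card_subset_eq) (auto simp: card_image order_def)
qed

lemma sum_V: "(\<Sum>v\<in>V. f v) = (\<Sum>k<d. \<Sum>i=1..n. along f i (int k))"
proof -
  have "(\<Sum>v\<in>V. f v) = (\<Sum>i=1..n. \<Sum>g\<in>carrier G. f (i, g))"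
    by (simp add: sum.cartesian_product)
  also have "\<dots> = (\<Sum>i=1..n. \<Sum>k<d. along f i (int k))"
    unfolding along_def by (intro sum.cong refl sum.reindex_bij_betw[symmetric] bij_pow)
  finally show ?thesis
    by (subst sum.swap)
qed

lemma periodic_along: "periodic d (along x i)"
proof -
  have "\<tau> [^] (k + int d) = \<tau> [^] k" for k
    by (simp add: pow_eq_iff)
  then show ?thesis
    by (simp add: periodic_def along_def)
qed

lemma along_dlog:
  assumes "\<And>i. periodic d (X i)"
  shows "X i (dlog (\<tau> [^] k)) = X i k"
proof -
  have "dlog (\<tau> [^] k) mod int d = k mod int d"
    using pow_dlog[of "\<tau> [^] k"] tau by (simp add: pow_eq_iff)
  then show ?thesis
    using periodic_mod[OF assms, of i] by metis
qed

text \<open>A vertex has exactly one neighbour over each \<open>j\<close> other than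
  \<open>i\<close>, so its degree is \<open>n - 1\<close>. Only neighbours between the fibres over 1
  and 2 lie in another layer, one step up or down, and \<open>?c\<close> records the resulting
  change.\<close>

lemma laplacian_sum:
  assumes "i \<in> {1..n}"
  shows "(\<Sum>u\<in>V. laplacian Y (i, \<tau> [^] k) u * x u) = cover_laplacian n (along x) i k"
proof -
  let ?g = "\<tau> [^] k" and ?\<alpha> = "single_voltage G \<tau> i"
  let ?v = "(i, ?g)" and ?N = "(\<lambda>j. (j, ?g \<otimes> ?\<alpha> j)) ` ({1..n} - {i})"
  let ?c = "\<lambda>j. if i = 1 then if j = 2 then along x 2 (k + 1) - along x 2 k else 0
    else if i = 2 then if j = 1 then along x 1 (k - 1) - along x 1 k else 0 else 0"
  have \<alpha>: "?\<alpha> j \<in> carrier G" for j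
    using tau by (simp add: single_voltage_def)
  have g: "?g \<in> carrier G" using tau by simp
  have arcs: "(?v, u) \<in> parcs Y \<longleftrightarrow> u \<in> ?N" for u
    using assms g \<alpha>
    by (cases u) (auto simp: single_voltage_cover_def derived_graph_def complete_pair_graph_def)
  have inj: "inj_on (\<lambda>j. (j, ?g \<otimes> ?\<alpha> j)) ({1..n} - {i})"
    by (simp add: inj_on_def)
  have N: "?N \<subseteq> V" using g \<alpha> by auto
  have "out_arcs (with_proj Y) ?v = Pair ?v ` ?N"
    using arcs by (auto simp: out_arcs_def)
  then have "out_degree (with_proj Y) ?v = card ?N"
    by (simp add: out_degree_def card_image inj_on_def)
  also have "\<dots> = n - 1"
    unfolding card_image[OF inj] using assms by simp
  finally have deg: "int (out_degree (with_proj Y) ?v) = int n - 1"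
    using n4 by simp
  have "(\<Sum>u\<in>V. laplacian Y ?v u * x u)
      = (\<Sum>u\<in>V. (if u = ?v then (int n - 1) * x u else 0) - (if u \<in> ?N then x u else 0))"
    using arcs deg by (intro sum.cong refl) (auto simp: laplacian_def degree_matrix_def adjacency_def)
  also have "\<dots> = (int n - 1) * x ?v - (\<Sum>u\<in>?N. x u)"
    using finite_V N assms g by (simp add: sum_subtractf sum.inter_restrict[symmetric] Int_absorb1)
  also have "(\<Sum>u\<in>?N. x u) = (\<Sum>j\<in>{1..n} - {i}. x (j, ?g \<otimes> ?\<alpha> j))"
    by (subst sum.reindex[OF inj]) simp
  also have "\<dots> = (\<Sum>j\<in>{1..n} - {i}. along x j k + ?c j)"
  proof (intro sum.cong refl)
    have "\<tau> [^] (k + 1) = ?g \<otimes> \<tau>" "\<tau> [^] (k - 1) = ?g \<otimes> inv \<tau>"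
      using tau by (simp_all add: int_pow_mult int_pow_diff)
    then show "x (j, ?g \<otimes> ?\<alpha> j) = along x j k + ?c j" for j
      using g by (auto simp: along_def single_voltage_def)
  qed
  also have "\<dots> = (\<Sum>j=1..n. along x j k) - along x i k +
      (if i = 1 then along x 2 (k + 1) - along x 2 k
       else if i = 2 then along x 1 (k - 1) - along x 1 k else 0)"
  proof -
    have "(\<Sum>j\<in>{1..n} - {i}. ?c j) =
      (if i = 1 then along x 2 (k + 1) - along x 2 k
       else if i = 2 then along x 1 (k - 1) - along x 1 k else 0)"
      using n4 by simp
    moreover have "(\<Sum>j\<in>{1..n} - {i}. along x j k) = (\<Sum>j=1..n. along x j k) - along x i k"
      using assms by (simp add: sum_diff1)
    ultimately show ?thesis by (simp only: sum.distrib)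
  qed
  finally show ?thesis
    by (simp add: cover_laplacian_def along_def algebra_simps)
qed

text \<open>
  Row \<open>w\<close> of a system with the full Laplacian follows from the others once the value at \<open>w\<close> makes the
  right-hand side sum to zero, and adding a constant to a solution makes it vanish at \<open>w\<close>. The reduced
  system is thus equivalent to the full one.
\<close>

definition complete_sum_zero :: "nat \<times> 'a \<Rightarrow> (nat \<times> 'a \<Rightarrow> int) \<Rightarrow> nat \<times> 'a \<Rightarrow> int" where
  "complete_sum_zero w f v =
     (if v = w then - (\<Sum>u\<in>V - {w}. f u) else if v \<in> V then f v else 0)"

lemma sum_complete_sum_zero:
  assumes "w \<in> V"
  shows "(\<Sum>v\<in>V. complete_sum_zero w f v) = 0"
proof -
  have "(\<Sum>v\<in>V - {w}. complete_sum_zero w f v) = (\<Sum>v\<in>V - {w}. f v)"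
    by (intro sum.cong refl) (auto simp: complete_sum_zero_def)
  then show ?thesis
    using sum.remove[OF finite_V assms, of "complete_sum_zero w f"]
    by (simp add: complete_sum_zero_def)
qed

lemma complete_sum_zero_eqI:
  assumes "w \<in> V" and "(\<Sum>v\<in>V. g v) = 0" and "\<And>v. v \<in> V - {w} \<Longrightarrow> f v = g v" and "v \<in> V"
  shows "complete_sum_zero w f v = g v"
proof -
  have "(\<Sum>u\<in>V - {w}. f u) = (\<Sum>u\<in>V - {w}. g u)"
    by (intro sum.cong refl assms(3))
  then show ?thesis
    using assms sum.remove[OF finite_V assms(1), of g] by (auto simp: complete_sum_zero_def)
qed

lemma complete_sum_zero_add:
  "complete_sum_zero w (\<lambda>v\<in>V - {w}. f v + g v) v = complete_sum_zero w f v + complete_sum_zero w g v"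
proof -
  have "(\<Sum>u\<in>V - {w}. (\<lambda>v\<in>V - {w}. f v + g v) u) = (\<Sum>u\<in>V - {w}. f u) + (\<Sum>u\<in>V - {w}. g u)"
    by (simp add: sum.distrib)
  then show ?thesis
    by (auto simp: complete_sum_zero_def)
qed

lemma reduced_laplacian_image_iff:
  assumes w: "w \<in> V" and f: "f \<in> carrier (free_int_module (V - {w}))"
  shows "f \<in> int_matrix_image (V - {w}) (V - {w}) (laplacian Y) \<longleftrightarrow>
    (\<exists>X. (\<forall>i. periodic d (X i)) \<and>
      (\<forall>i\<in>{1..n}. \<forall>k. along (complete_sum_zero w f) i k = cover_laplacian n X i k))"
    (is "?L \<longleftrightarrow> ?R")
proof
  assume ?L
  then obtain x where f_eq: "f = (\<lambda>v\<in>V - {w}. \<Sum>u\<in>V - {w}. laplacian Y v u * x u)"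
    by (auto simp: int_matrix_image_def)
  \<comment> \<open>Extension by zero at \<open>w\<close> turns the reduced matrix product into the
    full one.\<close>
  define x' where "x' u = (if u = w then 0 else x u)" for u
  define g where "g v = (\<Sum>u\<in>V. laplacian Y v u * x' u)" for v
  have red: "g v = (\<Sum>u\<in>V - {w}. laplacian Y v u * x u)" for v
  proof -
    have "(\<Sum>u\<in>V - {w}. laplacian Y v u * x' u) = (\<Sum>u\<in>V - {w}. laplacian Y v u * x u)"
      by (intro sum.cong refl) (auto simp: x'_def)
    then show ?thesis
      using sum.remove[OF finite_V w, of "\<lambda>u. laplacian Y v u * x' u"] by (simp add: g_def x'_def)
  qed
  have g: "along g i k = cover_laplacian n (along x') i k" if "i \<in> {1..n}" for i k
    using laplacian_sum[OF that, of k x'] by (simp add: along_def g_def)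
  have "(\<Sum>v\<in>V. g v) = (\<Sum>k<d. \<Sum>i=1..n. cover_laplacian n (along x') i (int k))"
    unfolding sum_V by (intro sum.cong refl g)
  also have "\<dots> = 0"
    by (rule sum_sum_cover_laplacian[OF n4 periodic_along])
  \<comment> \<open>\<open>f\<close> agrees with \<open>g\<close> away from \<open>w\<close>, and
    the zero sum of \<open>g\<close> forces its value at \<open>w\<close>.\<close>
  finally have "complete_sum_zero w f v = g v" if "v \<in> V" for v
    using w that by (intro complete_sum_zero_eqI) (auto simp: f_eq red)
  then have "along (complete_sum_zero w f) i k = along g i k" if "i \<in> {1..n}" for i k
    using that tau by (simp add: along_def)
  then show ?R
    using g periodic_along by (intro exI[of _ "along x'"]) auto
next
  assume ?R
  then obtain X where X: "\<And>i. periodic d (X i)"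
    and fX: "\<And>i k. i \<in> {1..n} \<Longrightarrow> along (complete_sum_zero w f) i k = cover_laplacian n X i k"
    by blast
  \<comment> \<open>This is the value at \<open>w\<close>; subtracting it makes the deleted column
    contribute nothing.\<close>
  define c where "c = X (fst w) (dlog (snd w))"
  define x where "x v = X (fst v) (dlog (snd v)) - c" for v
  have x: "along x = (\<lambda>i k. X i k - c)"
    by (simp add: along_def x_def fun_eq_iff along_dlog[of X, OF X])
  have xw: "x w = 0"
    by (simp add: x_def c_def)
  have "f v = (\<Sum>u\<in>V - {w}. laplacian Y v u * x u)" if v: "v \<in> V - {w}" for v
  proof -
    obtain i g where vig: "v = (i, g)" "i \<in> {1..n}" "g \<in> carrier G"
      using v by auto
    have "f v = along (complete_sum_zero w f) i (dlog g)"
      using v vig by (auto simp: complete_sum_zero_def along_def pow_dlog)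
    also have "\<dots> = cover_laplacian n (along x) i (dlog g)"
      using fX vig by (simp add: x cover_laplacian_shift)
    also have "\<dots> = (\<Sum>u\<in>V. laplacian Y v u * x u)"
      using laplacian_sum[OF vig(2), of "dlog g" x] vig by (simp add: pow_dlog)
    also have "\<dots> = (\<Sum>u\<in>V - {w}. laplacian Y v u * x u)"
      using sum.remove[OF finite_V w, of "\<lambda>u. laplacian Y v u * x u"] xw by simp
    finally show ?thesis .
  qed
  then have "f = (\<lambda>v\<in>V - {w}. \<Sum>u\<in>V - {w}. laplacian Y v u * restrict x (V - {w}) u)"
    using f by (auto simp: fun_eq_iff PiE_def extensional_def)
  then show ?L
    unfolding int_matrix_image_def by (rule image_eqI[where x = "restrict x (V - {w})"]) auto
qed

text \<open>The forms are applied to the zero-sum completion of \<open>f\<close>. They are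
  surjective because a vertex function of total sum zero is recovered by completing its restriction
  to the vertices other than \<open>w\<close>.\<close>

lemma jacobian_iso:
  assumes w: "w \<in> V"
  shows "jacobian Y w \<cong> cyclic_product (cover_moduli n d)"
  unfolding jacobian_def pverts_Y
proof (rule int_matrix_coker_iso_cyclic_product
    [where \<phi> = "\<lambda>f. cover_form n d (along (complete_sum_zero w f))"])
  show "0 \<notin> set (cover_moduli n d)"
    using n4 d2 by (auto simp: cover_moduli_def)
next
  fix f g j
  show "cover_form n d (along (complete_sum_zero w (\<lambda>v\<in>V - {w}. f v + g v))) j =
    cover_form n d (along (complete_sum_zero w f)) j + cover_form n d (along (complete_sum_zero w g)) j"
    unfolding cover_form_add[symmetric] along_def complete_sum_zero_add ..
next
  fix y :: "nat \<Rightarrow> int"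
  obtain F where per: "\<And>i. periodic d (F i)" and outside: "\<And>i k. i \<notin> {1..n} \<Longrightarrow> F i k = 0"
    and zero: "\<And>k. (\<Sum>i=1..n. F i k) = 0"
    and F: "\<And>j. j < length (cover_moduli n d) \<Longrightarrow> cover_form n d F j = y j"
    using cover_form_surj[OF n4 d2, of y] by metis
  define g where "g v = F (fst v) (dlog (snd v))" for v
  have g: "along g = F"
    by (simp add: fun_eq_iff along_def g_def along_dlog[of F, OF per])
  have "(\<Sum>v\<in>V. g v) = 0"
    unfolding sum_V g zero by simp
  then have eq: "complete_sum_zero w (restrict g (V - {w})) v = g v" if "v \<in> V" for v
    using w that by (intro complete_sum_zero_eqI) auto
  have "along (complete_sum_zero w (restrict g (V - {w}))) i k = F i k" for i k
  proof (cases "i \<in> {1..n}")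
    case True
    then show ?thesis
      using eq[of "(i, \<tau> [^] k)"] tau g by (simp add: along_def fun_eq_iff)
  next
    \<comment> \<open>Outside the index range both sides are zero by their default values, so the
      two agree as functions.\<close>
    case False
    then show ?thesis
      using outside[OF False] w by (auto simp: along_def complete_sum_zero_def)
  qed
  then have "along (complete_sum_zero w (restrict g (V - {w}))) = F"
    by (simp add: fun_eq_iff)
  then show "\<exists>f\<in>carrier (free_int_module (V - {w})).
      \<forall>j<length (cover_moduli n d). cover_form n d (along (complete_sum_zero w f)) j = y j"
    using F by (intro bexI[of _ "restrict g (V - {w})"]) auto
next
  fix f assume f: "f \<in> carrier (free_int_module (V - {w}))"
  have "(\<Sum>k<d. \<Sum>i=1..n. along (complete_sum_zero w f) i (int k)) = 0"
    using sum_complete_sum_zero[OF w, of f] unfolding sum_V .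
  then show "f \<in> int_matrix_image (V - {w}) (V - {w}) (laplacian Y) \<longleftrightarrow>
      (\<forall>j<length (cover_moduli n d).
        int (cover_moduli n d ! j) dvd cover_form n d (along (complete_sum_zero w f)) j)"
    unfolding reduced_laplacian_image_iff[OF w f] cover_form_dvd_iff[OF n4 d2]
    by (rule cover_laplacian_image_iff[OF n4 d2 periodic_along])
qed

end

section \<open>Order and invariant factors from the list of moduli\<close>

lemma cyclic_product_cover_moduli:
  "cyclic_product (cover_moduli n d) \<cong> cyclic_power n ((n - 4) * d + 2)
     \<times>\<times> cyclic_power (n * (n - 2)) (d - 2) \<times>\<times> integer_mod_group (d * n * (n - 2))"
proof -
  let ?A = "replicate ((n - 4) * d + 2) n"
  let ?B = "replicate (d - 2) (n * (n - 2))" and ?m = "d * n * (n - 2)"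
  have "cyclic_product ?B \<times>\<times> cyclic_product [?m] \<cong> cyclic_product ?B \<times>\<times> integer_mod_group ?m"
    by (intro group.DirProd_iso_trans iso_refl cyclic_product_singleton) simp
  from iso_trans[OF cyclic_product_append this]
  have "cyclic_product ?A \<times>\<times> cyclic_product (?B @ [?m])
      \<cong> cyclic_product ?A \<times>\<times> cyclic_product ?B \<times>\<times> integer_mod_group ?m"
    by (intro group.DirProd_iso_trans iso_refl) simp_all
  from iso_trans[OF cyclic_product_append this] show ?thesis
    unfolding cover_moduli_def cyclic_product_replicate .
qed

lemma prod_list_cover_moduli:
  assumes "n \<ge> 4" and "d \<ge> 2"
  shows "prod_list (cover_moduli n d) = n ^ ((n - 3) * d + 1) * (n - 2) ^ (d - 1) * d"
proof -
  \<comment> \<open>Writing \<open>d = c + 2\<close> removes truncated subtraction from the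
    exponents.\<close>
  obtain c where d: "d = c + 2" using assms(2) by (metis le_add_diff_inverse2)
  have n3: "n - 3 = Suc (n - 4)" using assms(1) by simp
  have *: "x ^ (e + 2) * ((x * y) ^ c * (z * x * y)) = x ^ (e + c + 3) * y ^ (c + 1) * z"
    for x y z e :: nat
    by (simp add: power_mult_distrib power_add power3_eq_cube power2_eq_square)
  have "prod_list (cover_moduli n d) = n ^ ((n - 4) * d + 2) * ((n * (n - 2)) ^ c * (d * n * (n - 2)))"
    unfolding cover_moduli_def prod_list.append prod_list_replicate by (simp add: d)
  also have "\<dots> = n ^ ((n - 4) * d + c + 3) * (n - 2) ^ (c + 1) * d"
    by (rule *)
  also have "(n - 4) * d + c + 3 = (n - 3) * d + 1"
    unfolding n3 using d by simp
  also have "c + 1 = d - 1"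
    using d by simp
  finally show ?thesis .
qed

lemma invariant_factors_cover_moduli:
  assumes "n \<ge> 4" and "d \<ge> 2" and "A \<cong> cyclic_product (cover_moduli n d)"
  shows "invariant_factors A (cover_moduli n d)"
proof -
  have "\<forall>m\<in>set (cover_moduli n d). m > 1"
  proof -
    have m: "4 * 2 \<le> n * (n - 2)"
      using assms(1) by (intro mult_le_mono) auto
    have "2 * (4 * 2) \<le> d * (n * (n - 2))"
      by (rule mult_le_mono[OF assms(2) m])
    with m show ?thesis
      using assms(1) by (auto simp: cover_moduli_def mult.assoc)
  qed
  moreover have "sorted_wrt (dvd) (cover_moduli n d)"
  proof -
    have "sorted_wrt (dvd) (replicate k m)" for k m :: nat
      by (induction k) auto
    then show ?thesis
      by (auto simp: cover_moduli_def sorted_wrt_append)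
  qed
  ultimately show ?thesis
    using assms(3) by (auto simp: invariant_factors_def intro: successively_if_sorted_wrt)
qed

theorem theorem1:
  fixes n d :: nat and G :: "('g, 'b) monoid_scheme" and \<tau> :: 'g and w :: "nat \<times> 'g"
  assumes "n \<ge> 4" and "d \<ge> 3"
    and "group G" and "\<tau> \<in> carrier G" and "generate G {\<tau>} = carrier G" and "order G = d"
    and "w \<in> pverts (single_voltage_cover n G \<tau>)"
  shows "jacobian (single_voltage_cover n G \<tau>) w \<cong>
           cyclic_power n ((n - 4) * d + 2) \<times>\<times> cyclic_power (n * (n - 2)) (d - 2)
             \<times>\<times> integer_mod_group (d * n * (n - 2))
         \<and> order (jacobian (single_voltage_cover n G \<tau>) w) =
           n ^ ((n - 3) * d + 1) * (n - 2) ^ (d - 1) * d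
         \<and> num_invariant_factors (jacobian (single_voltage_cover n G \<tau>) w) = (n - 3) * d + 1
         \<and> min_generators (jacobian (single_voltage_cover n G \<tau>) w) = (n - 3) * d + 1"
proof -
  have d2: "d \<ge> 2" using \<open>d \<ge> 3\<close> by simp
  interpret cyclic_cover G \<tau> n d
    using assms d2 by (intro cyclic_cover.intro cyclic_cover_axioms.intro)
  let ?J = "jacobian Y w"
  have iso: "?J \<cong> cyclic_product (cover_moduli n d)"
    using assms(7) by (intro jacobian_iso) (simp add: pverts_Y)
  have grp: "group ?J"
    unfolding jacobian_def by (rule group_int_matrix_coker)
  have inv: "invariant_factors ?J (cover_moduli n d)"
    by (rule invariant_factors_cover_moduli[OF \<open>n \<ge> 4\<close> d2 iso])
  have "0 \<notin> set (cover_moduli n d)"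
    using inv by (auto simp: invariant_factors_def)
  then have "order ?J = n ^ ((n - 3) * d + 1) * (n - 2) ^ (d - 1) * d"
    using order_iso[OF iso] order_cyclic_product prod_list_cover_moduli[OF \<open>n \<ge> 4\<close> d2] by metis
  then show ?thesis
    using iso_trans[OF iso cyclic_product_cover_moduli]
      num_invariant_factors_eq[OF grp inv] min_generators_invariant_factors[OF grp inv]
      length_cover_moduli'[OF \<open>n \<ge> 4\<close> d2]
    by simp
qed

end
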